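(* Let $G_n=(V(G_n),E(G_n))$, $n\geq 1$, be random graphs with $|V(G_n)|=n$. Assume that $G_n$ converges locally in probability to $(G,o)\sim\mu$, that $$\lim_{k\to\infty}\limsup_{n\to\infty}\frac{1}{n^2}\mathbb{E}\Big[\#\big\{(x,y)\in V(G_n)\times V(G_n)\colon |\mathscr{C}(x)|\geq k,\ |\mathscr{C}(y)|\geq k,\ x\notin\mathscr{C}(y)\big\}\Big]=0,$$ and that $\zeta=\mu(|\mathscr{C}(o)|=\infty)>0$. Then, for every $\ell$, as $n\to\infty$, $$\frac{v_\ell(\mathscr{C}_{\rm max})}{n}\to\mu\big(|\mathscr{C}(o)|=\infty,\ d_o^{(G)}=\ell\big)\quad\text{in probability}.$$ Further, assume in addition that the sequence $(D_n)_{n\geq1}$ with $D_n=d_{o_n}^{(G_n)}$, where $o_n\in V(G_n)$ is chosen uniformly at random, is uniformly integrable. Then $$\frac{|E(\mathscr{C}_{\rm max})|}{n}\to\tfrac12\,\mathbb{E}_\mu\Big[d_o^{(G)}\mathbf{1}_{\{|\mathscr{C}(o)|=\infty\}}\Big]\quad\text{in probability}.$$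
   Context: Graphs $G=(V(G),E(G))$ are locally finite. For $v\in V(G)$, $\mathscr{C}(v)$ denotes the connected component of $v$, $|\mathscr{C}(v)|$ its number of vertices, and $d_v^{(G)}$ the degree of $v$ in $G$. $\mathscr{C}_{\rm max}$ is the largest connected component of $G_n$ (ties broken arbitrarily); $v_\ell(\mathscr{C}_{\rm max})$ is the number of vertices of degree $\ell$ in $\mathscr{C}_{\rm max}$ and $|E(\mathscr{C}_{\rm max})|$ its number of edges. $\mathbb{E}_\mu$ is expectation with respect to $(G,o)\sim\mu$. Local convergence in probability: Let $\mathscr{G}_\star$ be the set of (possibly infinite) locally finite connected rooted graphs modulo rooted isomorphism $\simeq$ (a bijection of vertex sets preserving the root and adjacency). With $d_G$ the graph distance, $B_r^{(G)}(o)$ is the subgraph rooted at $o$ with vertex set $\{u\colon d_G(o,u)\leq r\}$ and all edges of $G$ between such vertices. Let $\mu$ be a probability measure on $\mathscr{G}_\star$, and let $(G,o)\sim\mu$. Then $G_n$ converges locally in probability to $(G,o)\sim\mu$ when, for every integer $r\geq 0$ and $H_\star\in\mathscr{G}_\star$, $\frac{1}{|V(G_n)|}\sum_{v\in V(G_n)}\mathbf{1}_{\{B_r^{(G_n)}(v)\simeq H_\star\}}$ converges in probability to $\mu(B_r^{(G)}(o)\simeq H_\star)$. *)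

theory Defs
  imports "HOL-Probability.Probability" "HOL-Library.Extended_Nat"
begin

datatype 'v graph = Graph (verts: "'v set") (edges: "'v set set")

definition simple_graph :: "'v graph \<Rightarrow> bool" where
  "simple_graph G \<longleftrightarrow> (\<forall>e\<in>edges G. e \<subseteq> verts G \<and> card e = 2)"

definition adj_rel :: "'v graph \<Rightarrow> ('v \<times> 'v) set" where
  "adj_rel G = {(u, v). {u, v} \<in> edges G}"

definition degree :: "'v graph \<Rightarrow> 'v \<Rightarrow> nat" where
  "degree G v = card {u. (v, u) \<in> adj_rel G}"

definition locally_finite :: "'v graph \<Rightarrow> bool" where
  "locally_finite G \<longleftrightarrow> (\<forall>v\<in>verts G. finite {u. (v, u) \<in> adj_rel G})"

definition connected_graph :: "'v graph \<Rightarrow> bool" where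
  "connected_graph G \<longleftrightarrow> (\<forall>u\<in>verts G. \<forall>v\<in>verts G. (u, v) \<in> (adj_rel G)\<^sup>*)"

definition induced_subgraph :: "'v graph \<Rightarrow> 'v set \<Rightarrow> 'v graph" where
  "induced_subgraph G W = Graph (verts G \<inter> W) {e \<in> edges G. e \<subseteq> W}"

definition component :: "'v graph \<Rightarrow> 'v \<Rightarrow> 'v graph" where
  "component G v = induced_subgraph G {u. (v, u) \<in> (adj_rel G)\<^sup>*}"

text \<open>The infimum of the empty set is \<open>\<infinity>\<close>, so vertices in different components are at infinite distance.\<close>

definition graph_dist :: "'v graph \<Rightarrow> 'v \<Rightarrow> 'v \<Rightarrow> enat" where
  "graph_dist G u v = (INF k \<in> {k. (u, v) \<in> adj_rel G ^^ k}. enat k)"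

definition graph_ball :: "'v graph \<Rightarrow> 'v \<Rightarrow> nat \<Rightarrow> 'v graph" where
  "graph_ball G v r = induced_subgraph G {u. graph_dist G v u \<le> enat r}"

definition is_largest_component :: "'v graph \<Rightarrow> 'v graph \<Rightarrow> bool" where
  "is_largest_component G C \<longleftrightarrow>
     (\<exists>v\<in>verts G. C = component G v) \<and>
     (\<forall>v\<in>verts G. card (verts (component G v)) \<le> card (verts C))"

definition is_rooted_iso :: "('v \<Rightarrow> 'w) \<Rightarrow> 'v graph \<times> 'v \<Rightarrow> 'w graph \<times> 'w \<Rightarrow> bool" where
  "is_rooted_iso f = (\<lambda>(G, a) (H, b).
     bij_betw f (verts G) (verts H) \<and> f a = b \<and>
     (\<forall>u\<in>verts G. \<forall>v\<in>verts G. (u, v) \<in> adj_rel G \<longleftrightarrow> (f u, f v) \<in> adj_rel H))"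

definition rooted_iso :: "'v graph \<times> 'v \<Rightarrow> 'w graph \<times> 'w \<Rightarrow> bool" where
  "rooted_iso x y \<longleftrightarrow> (\<exists>f. is_rooted_iso f x y)"

definition rooted_graphs :: "('v graph \<times> 'v) set" where
  "rooted_graphs =
     {(G, a). simple_graph G \<and> locally_finite G \<and> connected_graph G \<and> a \<in> verts G}"

definition rooted_eq :: "'v graph \<times> 'v \<Rightarrow> 'v graph \<times> 'v \<Rightarrow> bool" where
  "rooted_eq x y \<longleftrightarrow> x \<in> rooted_graphs \<and> y \<in> rooted_graphs \<and> rooted_iso x y"

lemma rooted_iso_refl: "rooted_iso x x"
proof -
  have "is_rooted_iso id x x" by (cases x) (auto simp: is_rooted_iso_def)
  then show ?thesis unfolding rooted_iso_def by blast
qed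

lemma is_rooted_iso_inv:
  assumes "is_rooted_iso f (G, a) (H, b)" "a \<in> verts G"
  shows "is_rooted_iso (inv_into (verts G) f) (H, b) (G, a)"
proof -
  let ?g = "inv_into (verts G) f"
  have f: "bij_betw f (verts G) (verts H)" "f a = b"
    and adj: "\<And>u v. u \<in> verts G \<Longrightarrow> v \<in> verts G \<Longrightarrow> (u, v) \<in> adj_rel G \<longleftrightarrow> (f u, f v) \<in> adj_rel H"
    using assms(1) by (auto simp: is_rooted_iso_def)
  have "bij_betw ?g (verts H) (verts G)" using f(1) by (rule bij_betw_inv_into)
  moreover have "?g b = a" using f assms(2) by (metis bij_betw_inv_into_left)
  moreover have "(u, v) \<in> adj_rel H \<longleftrightarrow> (?g u, ?g v) \<in> adj_rel G"
    if "u \<in> verts H" "v \<in> verts H" for u v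
  proof -
    have "?g u \<in> verts G" "?g v \<in> verts G"
      using calculation(1) that by (auto dest: bij_betwE)
    moreover have "f (?g u) = u" "f (?g v) = v"
      using f(1) that by (auto intro: bij_betw_inv_into_right)
    ultimately show ?thesis using adj by metis
  qed
  ultimately show ?thesis by (auto simp: is_rooted_iso_def)
qed

lemma rooted_eq_sym: "rooted_eq x y \<Longrightarrow> rooted_eq y x"
  by (cases x; cases y)
    (auto simp: rooted_eq_def rooted_iso_def rooted_graphs_def dest: is_rooted_iso_inv)

lemma rooted_eq_trans:
  assumes "rooted_eq x y" "rooted_eq y z"
  shows "rooted_eq x z"
proof -
  obtain f g where fg: "is_rooted_iso f x y" "is_rooted_iso g y z"
    using assms by (auto simp: rooted_eq_def rooted_iso_def)
  obtain G a H b K c where xyz: "x = (G, a)" "y = (H, b)" "z = (K, c)"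
    by (cases x, cases y, cases z)
  have f: "bij_betw f (verts G) (verts H)" "f a = b"
    and g: "bij_betw g (verts H) (verts K)" "g b = c"
    and adj: "\<And>u v. u \<in> verts G \<Longrightarrow> v \<in> verts G \<Longrightarrow> (u, v) \<in> adj_rel G \<longleftrightarrow> (f u, f v) \<in> adj_rel H"
      "\<And>u v. u \<in> verts H \<Longrightarrow> v \<in> verts H \<Longrightarrow> (u, v) \<in> adj_rel H \<longleftrightarrow> (g u, g v) \<in> adj_rel K"
    using fg by (simp_all add: is_rooted_iso_def xyz)
  have "bij_betw (g \<circ> f) (verts G) (verts K)" using f(1) g(1) by (rule bij_betw_trans)
  then have "is_rooted_iso (g \<circ> f) x z"
    using f g adj by (simp add: is_rooted_iso_def xyz bij_betw_apply)
  then show ?thesis using assms by (auto simp: rooted_eq_def rooted_iso_def)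
qed

text \<open>A connected locally finite graph has countably many vertices, so every isomorphism class
  has a representative with vertices in \<^typ>\<open>nat\<close>.\<close>

quotient_type rooted_class = "nat graph \<times> nat" / partial: rooted_eq
  morphisms rep_rooted_class rooted_class_of
proof (rule part_equivpI)
  have "(Graph {0} {}, 0) \<in> rooted_graphs"
    by (auto simp: rooted_graphs_def simple_graph_def locally_finite_def connected_graph_def
        adj_rel_def)
  then show "\<exists>x::nat graph \<times> nat. rooted_eq x x"
    using rooted_iso_refl unfolding rooted_eq_def by blast
  show "symp (rooted_eq :: nat graph \<times> nat \<Rightarrow> _)"
    by (rule sympI) (rule rooted_eq_sym)
  show "transp (rooted_eq :: nat graph \<times> nat \<Rightarrow> _)"
    by (rule transpI) (rule rooted_eq_trans)
qed

lemma adj_verts: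
  "simple_graph G \<Longrightarrow> (u, v) \<in> adj_rel G \<Longrightarrow> u \<in> verts G \<and> v \<in> verts G"
  by (auto simp: simple_graph_def adj_rel_def)

lemma is_rooted_iso_relpow:
  assumes "is_rooted_iso f (G, a) (H, b)" "simple_graph G" "u \<in> verts G"
    and "(u, v) \<in> adj_rel G ^^ k"
  shows "v \<in> verts G \<and> (f u, f v) \<in> adj_rel H ^^ k"
  using assms(4)
proof (induction k arbitrary: v)
  case 0
  then show ?case using assms(3) by simp
next
  case (Suc k)
  then obtain w where w: "(u, w) \<in> adj_rel G ^^ k" "(w, v) \<in> adj_rel G" by auto
  with Suc.IH have "(f u, f w) \<in> adj_rel H ^^ k" by blast
  moreover have "w \<in> verts G" "v \<in> verts G" using adj_verts[OF assms(2) w(2)] by auto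
  moreover from this have "(f w, f v) \<in> adj_rel H"
    using w(2) assms(1) by (simp add: is_rooted_iso_def)
  ultimately show ?case by auto
qed

lemma is_rooted_iso_relpow_iff:
  assumes iso: "is_rooted_iso f (G, a) (H, b)" and G: "simple_graph G" "a \<in> verts G"
    and H: "simple_graph H" and uv: "u \<in> verts G" "v \<in> verts G"
  shows "(f u, f v) \<in> adj_rel H ^^ k \<longleftrightarrow> (u, v) \<in> adj_rel G ^^ k"
proof
  let ?g = "inv_into (verts G) f"
  have bij: "bij_betw f (verts G) (verts H)" using iso by (auto simp: is_rooted_iso_def)
  assume "(f u, f v) \<in> adj_rel H ^^ k"
  then have "(?g (f u), ?g (f v)) \<in> adj_rel G ^^ k"
    using is_rooted_iso_relpow[OF is_rooted_iso_inv[OF iso G(2)] H] bij uv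
    by (auto dest: bij_betwE)
  then show "(u, v) \<in> adj_rel G ^^ k" using bij uv by (simp add: bij_betw_inv_into_left)
qed (use is_rooted_iso_relpow[OF iso G(1) uv(1)] in blast)

lemma is_rooted_iso_dist:
  assumes "is_rooted_iso f (G, a) (H, b)" "simple_graph G" "a \<in> verts G"
    and "simple_graph H" "u \<in> verts G" "v \<in> verts G"
  shows "graph_dist H (f u) (f v) = graph_dist G u v"
  unfolding graph_dist_def using is_rooted_iso_relpow_iff[OF assms] by simp

lemma adj_rel_induced:
  "adj_rel (induced_subgraph G W) = adj_rel G \<inter> W \<times> W"
  by (auto simp: adj_rel_def induced_subgraph_def)

lemma is_rooted_iso_induced:
  assumes iso: "is_rooted_iso f (G, a) (H, b)"
    and W: "\<And>u. u \<in> verts G \<Longrightarrow> u \<in> W \<longleftrightarrow> f u \<in> W'"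
  shows "is_rooted_iso f (induced_subgraph G W, a) (induced_subgraph H W', b)"
proof -
  have bij: "bij_betw f (verts G) (verts H)" using iso by (auto simp: is_rooted_iso_def)
  then have "f ` verts G = verts H" by (simp add: bij_betw_def)
  moreover have "f ` (verts G \<inter> W) = f ` verts G \<inter> W'"
    using W by auto
  ultimately have "f ` (verts G \<inter> W) = verts H \<inter> W'" by simp
  then have "bij_betw f (verts G \<inter> W) (verts H \<inter> W')"
    using bij by (auto simp: bij_betw_def intro: inj_on_subset)
  moreover have "f a = b"
    and "\<And>u v. u \<in> verts G \<Longrightarrow> v \<in> verts G \<Longrightarrow> (u, v) \<in> adj_rel G \<longleftrightarrow> (f u, f v) \<in> adj_rel H"
    using iso by (simp_all add: is_rooted_iso_def)
  ultimately show ?thesis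
    using W[symmetric] by (simp add: is_rooted_iso_def adj_rel_induced) (simp add: induced_subgraph_def)
qed

lemma graph_dist_le:
  "graph_dist G u v \<le> enat r \<longleftrightarrow> (\<exists>k\<le>r. (u, v) \<in> adj_rel G ^^ k)"
proof
  assume le: "graph_dist G u v \<le> enat r"
  let ?S = "enat ` {k. (u, v) \<in> adj_rel G ^^ k}"
  have "Inf ?S < enat (Suc r)"
    using le unfolding graph_dist_def by (simp add: order.strict_trans1)
  then show "\<exists>k\<le>r. (u, v) \<in> adj_rel G ^^ k"
    unfolding Inf_less_iff by (auto simp: less_Suc_eq_le)
next
  assume "\<exists>k\<le>r. (u, v) \<in> adj_rel G ^^ k"
  then show "graph_dist G u v \<le> enat r"
    unfolding graph_dist_def by (auto intro: INF_lower2)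
qed

lemma sym_adj: "sym (adj_rel G)"
  by (auto simp: sym_def adj_rel_def insert_commute)

lemma graph_ball_reaches:
  assumes "simple_graph G" "(a, v) \<in> adj_rel G ^^ k" "k \<le> r"
  shows "(a, v) \<in> (adj_rel (graph_ball G a r))\<^sup>*"
  using assms(2,3)
proof (induction k arbitrary: v)
  case (Suc k)
  then obtain w where w: "(a, w) \<in> adj_rel G ^^ k" "(w, v) \<in> adj_rel G" by auto
  have "graph_dist G a w \<le> enat r" "graph_dist G a v \<le> enat r"
    unfolding graph_dist_le using w(1) Suc.prems by (blast intro: Suc_leD)+
  then have "(w, v) \<in> adj_rel (graph_ball G a r)"
    using w(2) by (simp add: graph_ball_def adj_rel_induced)
  then show ?case using Suc.IH[OF w(1)] Suc.prems(2) by (auto intro: rtrancl_into_rtrancl)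
qed auto

lemma graph_ball_rooted:
  assumes "simple_graph G" "locally_finite G" "a \<in> verts G"
  shows "(graph_ball G a r, a) \<in> rooted_graphs"
proof -
  let ?B = "graph_ball G a r"
  have "simple_graph ?B"
    using assms(1) by (auto simp: simple_graph_def graph_ball_def induced_subgraph_def)
  moreover have "locally_finite ?B"
    unfolding locally_finite_def
  proof
    fix v assume "v \<in> verts ?B"
    then have "finite {u. (v, u) \<in> adj_rel G}"
      using assms(2) by (auto simp: locally_finite_def graph_ball_def induced_subgraph_def)
    then show "finite {u. (v, u) \<in> adj_rel ?B}"
      by (rule rev_finite_subset) (auto simp: graph_ball_def adj_rel_induced)
  qed
  moreover have "connected_graph ?B"
    unfolding connected_graph_def
  proof (intro ballI)
    have *: "(a, v) \<in> (adj_rel ?B)\<^sup>*" if "v \<in> verts ?B" for v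
      using that graph_ball_reaches[OF assms(1)]
      by (auto simp: graph_ball_def induced_subgraph_def graph_dist_le)
    fix u v assume "u \<in> verts ?B" "v \<in> verts ?B"
    then show "(u, v) \<in> (adj_rel ?B)\<^sup>*"
      using * sym_rtrancl[OF sym_adj] by (meson rtrancl_trans symD)
  qed
  moreover have "graph_dist G a a \<le> enat r"
    unfolding graph_dist_le by (intro exI[of _ 0]) auto
  then have "a \<in> verts ?B"
    using assms(3) by (simp add: graph_ball_def induced_subgraph_def)
  ultimately show ?thesis by (simp add: rooted_graphs_def)
qed

lift_definition root_ball :: "nat \<Rightarrow> rooted_class \<Rightarrow> rooted_class"
  is "\<lambda>r (G, a). (graph_ball G a r, a)"
proof -
  fix r :: nat and x y :: "nat graph \<times> nat"
  assume eq: "rooted_eq x y"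
  obtain G a H b where xy: "x = (G, a)" "y = (H, b)" by (cases x, cases y)
  have G: "simple_graph G" "locally_finite G" "a \<in> verts G"
    and H: "simple_graph H" "locally_finite H" "b \<in> verts H"
    using eq by (auto simp: rooted_eq_def rooted_graphs_def xy)
  obtain f where f: "is_rooted_iso f (G, a) (H, b)"
    using eq by (auto simp: rooted_eq_def rooted_iso_def xy)
  then have fa: "f a = b" by (auto simp: is_rooted_iso_def)
  have "is_rooted_iso f (graph_ball G a r, a) (graph_ball H b r, b)"
    unfolding graph_ball_def
    by (rule is_rooted_iso_induced[OF f])
      (use is_rooted_iso_dist[OF f G(1,3) H(1) G(3)] fa in simp)
  then show "rooted_eq (case x of (G, a) \<Rightarrow> (graph_ball G a r, a))
      (case y of (G, a) \<Rightarrow> (graph_ball G a r, a))"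
    using graph_ball_rooted[OF G] graph_ball_rooted[OF H]
    by (auto simp: xy rooted_eq_def rooted_iso_def)
qed

lift_definition root_degree :: "rooted_class \<Rightarrow> nat"
  is "\<lambda>(G, a). degree G a"
proof -
  fix x y :: "nat graph \<times> nat"
  assume eq: "rooted_eq x y"
  obtain G a H b where xy: "x = (G, a)" "y = (H, b)" by (cases x, cases y)
  have G: "simple_graph G" "a \<in> verts G" and H: "simple_graph H"
    using eq by (auto simp: rooted_eq_def rooted_graphs_def xy)
  obtain f where f: "is_rooted_iso f (G, a) (H, b)"
    using eq by (auto simp: rooted_eq_def rooted_iso_def xy)
  have bij: "bij_betw f (verts G) (verts H)" and fa: "f a = b"
    and adj: "\<And>u. u \<in> verts G \<Longrightarrow> (a, u) \<in> adj_rel G \<longleftrightarrow> (b, f u) \<in> adj_rel H"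
    using f G by (auto simp: is_rooted_iso_def)
  have "f ` {u. (a, u) \<in> adj_rel G} = {u. (b, u) \<in> adj_rel H}"
  proof (intro equalityI subsetI)
    fix w assume w: "w \<in> {u. (b, u) \<in> adj_rel H}"
    then have "w \<in> verts H" using adj_verts[OF H] by blast
    then obtain u where "u \<in> verts G" "w = f u"
      using bij by (auto simp: bij_betw_def)
    then show "w \<in> f ` {u. (a, u) \<in> adj_rel G}" using w adj by auto
  qed (use adj adj_verts[OF G(1)] in auto)
  moreover have "inj_on f {u. (a, u) \<in> adj_rel G}"
    using bij adj_verts[OF G(1)] by (auto simp: bij_betw_def intro: inj_on_subset)
  ultimately have "degree G a = degree H b"
    unfolding degree_def using card_image by metis
  then show "(case x of (G, a) \<Rightarrow> degree G a) = (case y of (G, a) \<Rightarrow> degree G a)"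
    by (simp add: xy)
qed

lift_definition root_component_infinite :: "rooted_class \<Rightarrow> bool"
  is "\<lambda>(G, a). infinite (verts (component G a))"
proof -
  fix x y :: "nat graph \<times> nat"
  assume eq: "rooted_eq x y"
  obtain G a H b where xy: "x = (G, a)" "y = (H, b)" by (cases x, cases y)
  have G: "connected_graph G" "a \<in> verts G" and H: "connected_graph H" "b \<in> verts H"
    using eq by (auto simp: rooted_eq_def rooted_graphs_def xy)
  obtain f where f: "bij_betw f (verts G) (verts H)"
    using eq by (auto simp: rooted_eq_def rooted_iso_def is_rooted_iso_def xy)
  have "verts (component G a) = verts G" "verts (component H b) = verts H"
    using G H by (auto simp: component_def induced_subgraph_def connected_graph_def)
  then show "(case x of (G, a) \<Rightarrow> infinite (verts (component G a))) =
      (case y of (G, a) \<Rightarrow> infinite (verts (component G a)))"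
    using bij_betw_finite[OF f] by (simp add: xy)
qed

text \<open>The Borel sigma-algebra of the local topology, whose basic open sets are the ball events.\<close>

definition local_algebra :: "rooted_class measure" where
  "local_algebra = sigma UNIV {{c. root_ball r c = H} | r H. True}"

text \<open>There are only countably many finite graphs with vertices in \<^typ>\<open>nat\<close>; the vertex set
  itself may be random.\<close>

definition is_random_graph :: "nat \<Rightarrow> 'w measure \<Rightarrow> ('w \<Rightarrow> nat graph) \<Rightarrow> bool" where
  "is_random_graph n M G \<longleftrightarrow>
     G \<in> M \<rightarrow>\<^sub>M count_space {K. simple_graph K \<and> finite (verts K) \<and> card (verts K) = n}"

text \<open>The limit is a constant, so the probability space may change with \<open>n\<close>.\<close>

definition tendsto_in_prob ::
    "(nat \<Rightarrow> 'w measure) \<Rightarrow> (nat \<Rightarrow> 'w \<Rightarrow> real) \<Rightarrow> real \<Rightarrow> bool" where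
  "tendsto_in_prob M X c \<longleftrightarrow>
     (\<forall>\<epsilon>>0. (\<lambda>n. measure (M n) {\<omega> \<in> space (M n). \<epsilon> < \<bar>X n \<omega> - c\<bar>}) \<longlonglongrightarrow> 0)"

text \<open>A ball in a finite simple graph belongs to \<^const>\<open>rooted_graphs\<close> (\<open>graph_ball_rooted\<close>), so
  \<^const>\<open>rooted_class_of\<close> is only applied within its domain.\<close>

definition locally_converges_in_prob ::
    "(nat \<Rightarrow> 'w measure) \<Rightarrow> (nat \<Rightarrow> 'w \<Rightarrow> nat graph) \<Rightarrow> rooted_class measure \<Rightarrow> bool" where
  "locally_converges_in_prob M G \<mu> \<longleftrightarrow>
     (\<forall>r H. tendsto_in_prob M
        (\<lambda>n \<omega>. (\<Sum>v\<in>verts (G n \<omega>). of_bool (rooted_class_of (graph_ball (G n \<omega>) v r, v) = H))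
                / real (card (verts (G n \<omega>))))
        (measure \<mu> {c. root_ball r c = H}))"

text \<open>The joint law of a random graph and a vertex that, given the graph, is uniform among its
  vertices.\<close>

definition uniform_root_law :: "'w measure \<Rightarrow> ('w \<Rightarrow> nat graph) \<Rightarrow> (nat graph \<times> nat) measure" where
  "uniform_root_law M G =
     M \<bind> (\<lambda>\<omega>. measure_pmf (map_pmf (\<lambda>v. (G \<omega>, v)) (pmf_of_set (verts (G \<omega>)))))"

definition uniformly_integrable ::
    "'i set \<Rightarrow> ('i \<Rightarrow> 'a measure) \<Rightarrow> ('i \<Rightarrow> 'a \<Rightarrow> real) \<Rightarrow> bool" where
  "uniformly_integrable I N X \<longleftrightarrow>
     (\<forall>i\<in>I. X i \<in> borel_measurable (N i)) \<and>
     ((\<lambda>K::real. SUP i\<in>I. \<integral>\<^sup>+x. ennreal \<bar>X i x\<bar> * indicator {x. K < \<bar>X i x\<bar>} x \<partial>N i)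
        \<longlongrightarrow> 0) at_top"

end

theory Submission
  imports Defs
begin

text \<open>
  Fix \<open>k \<ge> 1\<close> and call a vertex large if its component has at least \<open>k\<close> vertices. Whether a vertex is
  large, and what its degree is, can be seen in the ball of radius \<open>k\<close> around it, because balls gain
  a vertex with each unit of radius until they fill the component (\<open>graph_ball_large_or_component\<close>).
  Local convergence therefore gives the limits of \<open>Z / n\<close>, for the number \<open>Z\<close> of large vertices,
  and of the fraction of large vertices of degree \<open>l\<close> (\<open>ball_freq_tendsto\<close>). As \<open>k\<close> grows, these
  limits decrease to the probabilities that the component of the root is infinite, respectively
  infinite with a root of degree \<open>l\<close>.

  It remains to see that almost all large vertices lie in the largest component \<open>C\<close>. Each large
  vertex forms a separated pair with every large vertex outside its own component, and that
  component has at most \<open>|C|\<close> vertices; hence the number \<open>N\<close> of separated pairs satisfies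
  \<open>Z (Z - |C|) \<le> N\<close> (\<open>separated_pairs_lower_bound\<close>). Since \<open>Z\<close> is of order \<open>n\<close>, by positivity of
  the probability of an infinite component, and \<open>N\<close> is of smaller order than \<open>n\<^sup>2\<close> in the double
  limit, Markov's inequality gives \<open>Z - |C| \<le> \<epsilon> n\<close> with high probability. As soon as \<open>Z > 0\<close>, the
  vertices of \<open>C\<close> are large themselves, so the counts of vertices of degree \<open>l\<close> in \<open>C\<close> and
  among all large vertices differ by at most \<open>Z - |C|\<close> (\<open>degree_count_close\<close>).

  For the edges, \<open>2 |E(C)|\<close> is the sum of the degrees in \<open>C\<close>, that is, the sum over \<open>l\<close> of
  \<open>l\<close> times the number of vertices of degree \<open>l\<close>. The sum over \<open>l \<le> L\<close> converges by the first
  part. The rest is at most the sum of all degrees above \<open>L\<close> in the graph, whose expectation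
  divided by \<open>n\<close> is small uniformly in \<open>n\<close> by uniform integrability (\<open>degree_tail_expectation\<close>).
  The same bound makes the limits of the truncated sums converge as \<open>L\<close> grows
  (\<open>degree_prob_convergent\<close>), and monotone convergence identifies their limit with the expectation
  under \<open>\<mu>\<close>.
\<close>

section \<open>Balls, components and degrees\<close>

lemma adj_rel_iff: "(u, v) \<in> adj_rel G \<longleftrightarrow> {u, v} \<in> edges G"
  by (simp add: adj_rel_def)

lemma verts_graph_ball:
  "verts (graph_ball G a r) = {u \<in> verts G. \<exists>k\<le>r. (a, u) \<in> adj_rel G ^^ k}"
  by (auto simp: graph_ball_def induced_subgraph_def graph_dist_le)

lemma verts_component: "verts (component G a) = {u \<in> verts G. (a, u) \<in> (adj_rel G)\<^sup>*}"
  by (auto simp: component_def induced_subgraph_def)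

lemma reachable_in_verts:
  assumes "simple_graph G" "a \<in> verts G" "(a, u) \<in> (adj_rel G)\<^sup>*"
  shows "u \<in> verts G"
  using assms(3,2) by (induction) (auto dest: adj_verts[OF assms(1)])

lemma relpow_in_verts:
  assumes "simple_graph G" "a \<in> verts G" "(a, u) \<in> adj_rel G ^^ k"
  shows "u \<in> verts G"
  using reachable_in_verts[OF assms(1,2)] relpow_imp_rtrancl[OF assms(3)] by blast

lemma finite_graph_ball:
  assumes "simple_graph G" "locally_finite G" "a \<in> verts G"
  shows "finite (verts (graph_ball G a r))"
proof -
  have "finite {u. (a, u) \<in> adj_rel G ^^ k}" for k
  proof (induction k)
    case (Suc k)
    have "{u. (a, u) \<in> adj_rel G ^^ Suc k}
        = (\<Union>w\<in>{w. (a, w) \<in> adj_rel G ^^ k}. {u. (w, u) \<in> adj_rel G})"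
      by auto
    moreover have "finite {u. (w, u) \<in> adj_rel G}" if "(a, w) \<in> adj_rel G ^^ k" for w
      using assms(2) relpow_in_verts[OF assms(1,3) that] by (simp add: locally_finite_def)
    ultimately show ?case using Suc by auto
  qed auto
  then have "finite (\<Union>k\<in>{..r}. {u. (a, u) \<in> adj_rel G ^^ k})" by blast
  then show ?thesis
    by (rule rev_finite_subset) (auto simp: verts_graph_ball)
qed

lemma graph_ball_subset_component: "verts (graph_ball G a r) \<subseteq> verts (component G a)"
  by (auto simp: verts_graph_ball verts_component dest: relpow_imp_rtrancl)

lemma graph_ball_mono: "r \<le> s \<Longrightarrow> verts (graph_ball G a r) \<subseteq> verts (graph_ball G a s)"
  by (auto simp: verts_graph_ball) (meson order_trans)

lemma root_in_graph_ball: "a \<in> verts G \<Longrightarrow> a \<in> verts (graph_ball G a r)"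
  by (auto simp: verts_graph_ball intro!: exI[of _ 0])

lemma neighbour_in_graph_ball:
  assumes "simple_graph G" "u \<in> verts (graph_ball G a r)" "(u, w) \<in> adj_rel G"
  shows "w \<in> verts (graph_ball G a (Suc r))"
proof -
  obtain k where "k \<le> r" "(a, u) \<in> adj_rel G ^^ k"
    using assms(2) by (auto simp: verts_graph_ball)
  then have "Suc k \<le> Suc r" "(a, w) \<in> adj_rel G ^^ Suc k"
    using assms(3) by auto
  then show ?thesis
    using adj_verts[OF assms(1,3)] unfolding verts_graph_ball by blast
qed

text \<open>As long as enlarging the radius adds a vertex, the ball gains at least one vertex per step;
  once a step adds nothing, the ball is closed under adjacency and hence the whole component.\<close>

lemma graph_ball_large_or_component:
  assumes "simple_graph G" "locally_finite G" "a \<in> verts G"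
  shows "r < card (verts (graph_ball G a r)) \<or>
    verts (graph_ball G a r) = verts (component G a)"
proof (induction r)
  case 0
  have "card (verts (graph_ball G a 0)) > 0"
    using root_in_graph_ball[OF assms(3)] finite_graph_ball[OF assms] card_gt_0_iff by blast
  then show ?case by blast
next
  case (Suc r)
  let ?B = "\<lambda>r. verts (graph_ball G a r)"
  have sub: "?B r \<subseteq> ?B (Suc r)" by (rule graph_ball_mono) simp
  show ?case
  proof (cases "?B (Suc r) = ?B r")
    case True
    have "u \<in> ?B r" if "(a, u) \<in> (adj_rel G)\<^sup>*" for u
      using that
    proof induction
      case base
      show ?case by (rule root_in_graph_ball[OF assms(3)])
    next
      case (step u w)
      then show ?case using neighbour_in_graph_ball[OF assms(1) step.IH] True by simp
    qed
    then have "verts (component G a) \<subseteq> ?B r" unfolding verts_component by (intro subsetI) simp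
    then have "?B (Suc r) = verts (component G a)"
      unfolding True by (intro equalityI graph_ball_subset_component)
    then show ?thesis ..
  next
    case False
    then have "card (?B r) < card (?B (Suc r))"
      using sub finite_graph_ball[OF assms] by (intro psubset_card_mono) auto
    moreover have "?B (Suc r) = verts (component G a)" if "?B r = verts (component G a)"
      using that sub graph_ball_subset_component[of G a "Suc r"] by (intro equalityI) auto
    ultimately show ?thesis using Suc.IH by linarith
  qed
qed

text \<open>This makes the size condition on components a local one: a ball of radius \<open>k\<close> with fewer than
  \<open>k\<close> vertices has stopped growing.\<close>

lemma graph_ball_size_iff:
  assumes "simple_graph G" "locally_finite G" "a \<in> verts G"
  shows "k \<le> card (verts (graph_ball G a k)) \<longleftrightarrow>
    infinite (verts (component G a)) \<or> k \<le> card (verts (component G a))"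
proof
  assume le: "k \<le> card (verts (graph_ball G a k))"
  have "card (verts (graph_ball G a k)) \<le> card (verts (component G a))"
    if "finite (verts (component G a))"
    using that graph_ball_subset_component by (rule card_mono)
  then show "infinite (verts (component G a)) \<or> k \<le> card (verts (component G a))"
    using le by linarith
next
  assume large: "infinite (verts (component G a)) \<or> k \<le> card (verts (component G a))"
  show "k \<le> card (verts (graph_ball G a k))"
  proof (cases "verts (graph_ball G a k) = verts (component G a)")
    case True
    then show ?thesis using large finite_graph_ball[OF assms, of k] by simp
  next
    case False
    then show ?thesis using graph_ball_large_or_component[OF assms, of k] by linarith
  qed
qed

lemma degree_induced_subgraph:
  assumes "simple_graph G" "v \<in> W" "\<And>u. (v, u) \<in> adj_rel G \<Longrightarrow> u \<in> W"
  shows "degree (induced_subgraph G W) v = degree G v"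
proof -
  have "{u. (v, u) \<in> adj_rel (induced_subgraph G W)} = {u. (v, u) \<in> adj_rel G}"
    using assms by (auto simp: adj_rel_induced)
  then show ?thesis by (simp add: degree_def)
qed

lemma degree_graph_ball:
  assumes "simple_graph G" "a \<in> verts G" "1 \<le> r"
  shows "degree (graph_ball G a r) a = degree G a"
  unfolding graph_ball_def
proof (rule degree_induced_subgraph[OF assms(1)])
  have "0 \<le> r \<and> (a, a) \<in> adj_rel G ^^ 0" by simp
  then show "a \<in> {u. graph_dist G a u \<le> enat r}" unfolding graph_dist_le mem_Collect_eq by blast
  fix u assume "(a, u) \<in> adj_rel G"
  then have "1 \<le> r \<and> (a, u) \<in> adj_rel G ^^ 1" using assms(3) by simp
  then show "u \<in> {u. graph_dist G a u \<le> enat r}" unfolding graph_dist_le mem_Collect_eq by blast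
qed

lemma degree_component:
  assumes "simple_graph G" "v \<in> verts (component G a)"
  shows "degree (component G a) v = degree G v"
  unfolding component_def
  by (rule degree_induced_subgraph[OF assms(1)])
    (use assms(2) in \<open>auto simp: verts_component intro: rtrancl_into_rtrancl\<close>)

lemma simple_graph_component: "simple_graph G \<Longrightarrow> simple_graph (component G a)"
  by (auto simp: simple_graph_def component_def induced_subgraph_def)

lemma component_eq:
  assumes "simple_graph G" "b \<in> verts (component G a)"
  shows "component G b = component G a"
proof -
  have ab: "(a, b) \<in> (adj_rel G)\<^sup>*" using assms(2) by (simp add: verts_component)
  then have "(b, a) \<in> (adj_rel G)\<^sup>*" using sym_rtrancl[OF sym_adj] by (meson symD)
  then have "{u. (b, u) \<in> (adj_rel G)\<^sup>*} = {u. (a, u) \<in> (adj_rel G)\<^sup>*}"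
    using ab by (auto intro: rtrancl_trans)
  then show ?thesis by (simp add: component_def)
qed

lemma component_subset: "verts (component G a) \<subseteq> verts G"
  by (auto simp: verts_component)

lemma component_sym:
  assumes "x \<in> verts (component G y)" "y \<in> verts G"
  shows "y \<in> verts (component G x)"
  using assms sym_rtrancl[OF sym_adj[of G]] by (auto simp: verts_component dest: symD)

lemma finite_edges:
  assumes "simple_graph G" "finite (verts G)"
  shows "finite (edges G)"
  by (rule finite_subset[of _ "Pow (verts G)"]) (use assms in \<open>auto simp: simple_graph_def\<close>)

lemma locally_finite_if_finite:
  assumes "simple_graph G" "finite (verts G)"
  shows "locally_finite G"
  unfolding locally_finite_def
proof
  fix v
  show "finite {u. (v, u) \<in> adj_rel G}"
    by (rule finite_subset[OF _ assms(2)]) (use adj_verts[OF assms(1)] in blast)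
qed

lemma degree_eq_card_incident:
  assumes "simple_graph G"
  shows "degree G v = card {e \<in> edges G. v \<in> e}"
  unfolding degree_def
proof (rule bij_betw_same_card[of "\<lambda>u. {v, u}"])
  have "\<exists>u. e = {v, u}" if e: "e \<in> edges G" "v \<in> e" for e
  proof -
    have "card e = 2" using e assms by (simp add: simple_graph_def)
    then obtain p q where "e = {p, q}" by (auto simp: card_2_iff)
    then show ?thesis using e by auto
  qed
  then show "bij_betw (\<lambda>u. {v, u}) {u. (v, u) \<in> adj_rel G} {e \<in> edges G. v \<in> e}"
    by (auto simp: bij_betw_def inj_on_def adj_rel_iff doubleton_eq_iff)
qed

text \<open>Double counting of the pairs of a vertex and an incident edge.\<close>

lemma handshake:
  assumes "simple_graph G" "finite (verts G)"
  shows "(\<Sum>v\<in>verts G. degree G v) = 2 * card (edges G)"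
  unfolding degree_eq_card_incident[OF assms(1)]
proof (rule sum_multicount[OF assms(2) finite_edges[OF assms]])
  show "\<forall>e\<in>edges G. card {v \<in> verts G. v \<in> e} = 2"
  proof
    fix e assume "e \<in> edges G"
    then have "e \<subseteq> verts G" "card e = 2" using assms(1) by (auto simp: simple_graph_def)
    moreover from this have "{v \<in> verts G. v \<in> e} = e" by blast
    ultimately show "card {v \<in> verts G. v \<in> e} = 2" by simp
  qed
qed

section \<open>The largest component among the large components\<close>

definition large_verts :: "'v graph \<Rightarrow> nat \<Rightarrow> 'v set" where
  "large_verts G k = {v \<in> verts G. k \<le> card (verts (component G v))}"

definition separated_pairs :: "'v graph \<Rightarrow> nat \<Rightarrow> ('v \<times> 'v) set" where
  "separated_pairs G k = {(x, y). x \<in> verts G \<and> y \<in> verts G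
     \<and> k \<le> card (verts (component G x)) \<and> k \<le> card (verts (component G y))
     \<and> x \<notin> verts (component G y)}"

lemma largest_component_cases:
  assumes "is_largest_component G C"
  obtains a where "a \<in> verts G" "C = component G a"
  using assms by (auto simp: is_largest_component_def)

text \<open>If some component has \<open>k\<close> vertices, then so does the largest one.\<close>

lemma largest_component_subset_large_verts:
  assumes "simple_graph G" "is_largest_component G C" "large_verts G k \<noteq> {}"
  shows "verts C \<subseteq> large_verts G k"
proof
  fix x assume x: "x \<in> verts C"
  obtain a where a: "a \<in> verts G" "C = component G a"
    using assms(2) by (rule largest_component_cases)
  obtain v where "v \<in> verts G" "k \<le> card (verts (component G v))"
    using assms(3) by (auto simp: large_verts_def)
  then have "k \<le> card (verts C)"
    using assms(2) by (auto simp: is_largest_component_def intro: order_trans)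
  moreover have "component G x = C" using component_eq[OF assms(1)] x a by simp
  ultimately show "x \<in> large_verts G k"
    using x a component_subset[of G a] by (auto simp: large_verts_def)
qed

lemma card_separated_pairs_le:
  "finite (verts G) \<Longrightarrow> card (separated_pairs G k) \<le> card (verts G) ^ 2"
  using card_mono[of "verts G \<times> verts G" "separated_pairs G k"]
  by (auto simp: separated_pairs_def card_cartesian_product power2_eq_square)

text \<open>Every vertex of a large component is separated from all large vertices outside its own
  component, and that component is no larger than the largest one. So few separated pairs force
  nearly all large vertices into the largest component.\<close>

lemma separated_pairs_lower_bound:
  assumes G: "simple_graph G" "finite (verts G)" and C: "is_largest_component G C"
  shows "card (large_verts G k) * (card (large_verts G k) - card (verts C))
    \<le> card (separated_pairs G k)"
proof -
  let ?Z = "large_verts G k"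
  have fin: "finite ?Z" using G(2) by (simp add: large_verts_def)
  have eq: "separated_pairs G k = Sigma ?Z (\<lambda>x. ?Z - verts (component G x))"
  proof -
    have "x \<in> verts (component G y) \<longleftrightarrow> y \<in> verts (component G x)"
      if "x \<in> verts G" "y \<in> verts G" for x y
      using component_sym that by metis
    then show ?thesis unfolding separated_pairs_def large_verts_def by blast
  qed
  have "card ?Z * (card ?Z - card (verts C)) = (\<Sum>x\<in>?Z. card ?Z - card (verts C))" by simp
  also have "\<dots> \<le> (\<Sum>x\<in>?Z. card (?Z - verts (component G x)))"
  proof (rule sum_mono)
    fix x assume x: "x \<in> ?Z"
    have "card (verts (component G x)) \<le> card (verts C)"
      using C x by (auto simp: is_largest_component_def large_verts_def)
    moreover have "card ?Z - card (verts (component G x)) \<le> card (?Z - verts (component G x))"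
      by (rule diff_card_le_card_Diff) (rule finite_subset[OF component_subset G(2)])
    ultimately show "card ?Z - card (verts C) \<le> card (?Z - verts (component G x))" by linarith
  qed
  also have "\<dots> = card (separated_pairs G k)"
    unfolding eq by (rule card_SigmaI[symmetric]) (use fin in auto)
  finally show ?thesis .
qed

section \<open>Isomorphism classes of rooted graphs\<close>

lemma rooted_class_cases:
  obtains K a where "c = rooted_class_of (K, a)" "simple_graph K" "locally_finite K"
    "connected_graph K" "a \<in> verts K"
proof -
  obtain K a where Ka: "rep_rooted_class c = (K, a)" by (cases "rep_rooted_class c")
  have "rooted_eq (K, a) (K, a)"
    using Quotient3_rep_reflp[OF Quotient3_rooted_class, of c] Ka by simp
  moreover have "c = rooted_class_of (K, a)"
    using Quotient3_abs_rep[OF Quotient3_rooted_class, of c] Ka by simp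
  ultimately show thesis using that by (auto simp: rooted_eq_def rooted_graphs_def)
qed

lemma rooted_eq_refl: "x \<in> rooted_graphs \<Longrightarrow> rooted_eq x x"
  by (simp add: rooted_eq_def rooted_iso_refl)

text \<open>An infinite set has cardinality \<open>0\<close>, so this is the number of vertices only for finite graphs;
  it is applied to balls.\<close>

lift_definition root_size :: "rooted_class \<Rightarrow> nat" is "\<lambda>(G, a). card (verts G)"
  by (auto simp: rooted_eq_def rooted_iso_def is_rooted_iso_def intro: bij_betw_same_card)

lemma root_size_class:
  "(G, a) \<in> rooted_graphs \<Longrightarrow> root_size (rooted_class_of (G, a)) = card (verts G)"
  using root_size.abs_eq[OF rooted_eq_refl[of "(G, a)"]] by simp

lemma root_degree_class:
  "(G, a) \<in> rooted_graphs \<Longrightarrow> root_degree (rooted_class_of (G, a)) = degree G a"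
  using root_degree.abs_eq[OF rooted_eq_refl[of "(G, a)"]] by simp

lemma root_ball_class:
  "(G, a) \<in> rooted_graphs \<Longrightarrow>
    root_ball r (rooted_class_of (G, a)) = rooted_class_of (graph_ball G a r, a)"
  using root_ball.abs_eq[OF rooted_eq_refl[of "(G, a)"]] by simp

lemma root_component_infinite_class:
  "(G, a) \<in> rooted_graphs \<Longrightarrow>
    root_component_infinite (rooted_class_of (G, a)) \<longleftrightarrow> infinite (verts (component G a))"
  using root_component_infinite.abs_eq[OF rooted_eq_refl[of "(G, a)"]] by simp

lemma root_degree_root_ball:
  assumes "1 \<le> r"
  shows "root_degree (root_ball r c) = root_degree c"
proof (cases c rule: rooted_class_cases)
  case (1 K a)
  then have "(K, a) \<in> rooted_graphs" by (simp add: rooted_graphs_def)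
  then show ?thesis
    using 1 assms graph_ball_rooted[of K a r]
    by (simp add: root_ball_class root_degree_class degree_graph_ball)
qed

lemma root_size_root_ball_class:
  assumes "(K, a) \<in> rooted_graphs"
  shows "k \<le> root_size (root_ball k (rooted_class_of (K, a))) \<longleftrightarrow>
    infinite (verts (component K a)) \<or> k \<le> card (verts (component K a))"
proof -
  have K: "simple_graph K" "locally_finite K" "a \<in> verts K"
    using assms by (simp_all add: rooted_graphs_def)
  show ?thesis
    unfolding root_ball_class[OF assms] root_size_class[OF graph_ball_rooted[OF K]]
    by (rule graph_ball_size_iff[OF K])
qed

text \<open>Infinity of the component is a countable intersection of local events, hence measurable and
  approximated by them.\<close>

lemma root_component_infinite_iff:
  "root_component_infinite c \<longleftrightarrow> (\<forall>k. k \<le> root_size (root_ball k c))"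
proof (cases c rule: rooted_class_cases)
  case (1 K a)
  then have Ka: "(K, a) \<in> rooted_graphs" by (simp add: rooted_graphs_def)
  show ?thesis
    unfolding 1(1) root_component_infinite_class[OF Ka] root_size_root_ball_class[OF Ka]
    using not_less_eq_eq by blast
qed

text \<open>Both balls test the size of the same component, against different thresholds.\<close>

lemma root_size_root_ball_antimono:
  assumes "j \<le> k" "k \<le> root_size (root_ball k c)"
  shows "j \<le> root_size (root_ball j c)"
proof (cases c rule: rooted_class_cases)
  case (1 K a)
  then have Ka: "(K, a) \<in> rooted_graphs" by (simp add: rooted_graphs_def)
  show ?thesis
    using assms unfolding 1(1) root_size_root_ball_class[OF Ka] by (auto intro: order_trans)
qed

lemma countable_finite_graphs:
  "countable {K :: 'v::countable graph. simple_graph K \<and> finite (verts K)}"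
proof -
  let ?E = "{E :: 'v set set. finite E \<and> E \<subseteq> Collect finite}"
  have "countable ((Collect finite :: 'v set set) \<times> ?E)"
    by (intro countable_SIGMA countable_Collect_finite_subset countable_Collect_finite)
  then have "countable ((\<lambda>(V, E). Graph V E) ` (Collect finite \<times> ?E))" by (rule countable_image)
  moreover have "K \<in> (\<lambda>(V, E). Graph V E) ` (Collect finite \<times> ?E)"
    if K: "simple_graph K" "finite (verts K)" for K :: "'v graph"
  proof (rule image_eqI)
    show "K = (\<lambda>(V, E). Graph V E) (verts K, edges K)" by simp
    have "finite e" if "e \<in> edges K" for e
      using that K by (auto simp: simple_graph_def intro: finite_subset)
    then show "(verts K, edges K) \<in> Collect finite \<times> ?E" using K finite_edges[OF K] by auto
  qed
  ultimately show ?thesis by (blast intro: countable_subset)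
qed

text \<open>A ball of a locally finite graph is finite, so only countably many classes occur as balls.\<close>

lemma countable_range_root_ball: "countable (range (root_ball r))"
proof -
  let ?S = "{K :: nat graph. simple_graph K \<and> finite (verts K)} \<times> (UNIV :: nat set)"
  have "root_ball r c \<in> rooted_class_of ` ?S" for c
  proof (cases c rule: rooted_class_cases)
    case (1 K a)
    then have "(K, a) \<in> rooted_graphs" by (simp add: rooted_graphs_def)
    moreover have "simple_graph (graph_ball K a r)" "finite (verts (graph_ball K a r))"
      using 1 graph_ball_rooted[of K a r] finite_graph_ball[of K a r]
      by (auto simp: rooted_graphs_def)
    ultimately show ?thesis using 1 by (auto simp: root_ball_class)
  qed
  then have "range (root_ball r) \<subseteq> rooted_class_of ` ?S" by blast
  moreover have "countable (rooted_class_of ` ?S)"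
    by (intro countable_image countable_SIGMA countable_finite_graphs) auto
  ultimately show ?thesis by (rule countable_subset)
qed

text \<open>The sigma-algebra is generated by the events that prescribe one class; an arbitrary set of
  classes, even an uncountable one, meets the range of the ball map in a countable set.\<close>

lemma root_ball_vimage_sets:
  assumes "sets \<mu> = sets local_algebra"
  shows "{c. root_ball r c \<in> A} \<in> sets \<mu>"
proof -
  have "{c. root_ball r c = H} \<in> sets local_algebra" for H
    unfolding local_algebra_def by (rule in_measure_of) auto
  then have "(\<Union>H\<in>A \<inter> range (root_ball r). {c. root_ball r c = H}) \<in> sets \<mu>"
    unfolding assms
    by (intro sets.countable_UN'' countable_Int2 countable_range_root_ball)
  moreover have "{c. root_ball r c \<in> A} = (\<Union>H\<in>A \<inter> range (root_ball r). {c. root_ball r c = H})"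
    by auto
  ultimately show ?thesis by simp
qed

section \<open>Convergence in probability to a constant\<close>

lemma tendsto_in_prob_cong:
  assumes "\<And>n \<omega>. 1 \<le> n \<Longrightarrow> \<omega> \<in> space (M n) \<Longrightarrow> X n \<omega> = Y n \<omega>"
  shows "tendsto_in_prob M X c \<longleftrightarrow> tendsto_in_prob M Y c"
proof -
  have "(\<lambda>n. measure (M n) {\<omega> \<in> space (M n). \<epsilon> < \<bar>X n \<omega> - c\<bar>}) \<longlonglongrightarrow> 0 \<longleftrightarrow>
      (\<lambda>n. measure (M n) {\<omega> \<in> space (M n). \<epsilon> < \<bar>Y n \<omega> - c\<bar>}) \<longlonglongrightarrow> 0" for \<epsilon>
  proof (rule tendsto_cong)
    show "\<forall>\<^sub>F n in sequentially. measure (M n) {\<omega> \<in> space (M n). \<epsilon> < \<bar>X n \<omega> - c\<bar>}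
        = measure (M n) {\<omega> \<in> space (M n). \<epsilon> < \<bar>Y n \<omega> - c\<bar>}"
      using eventually_ge_at_top[of 1]
    proof eventually_elim
      case (elim n)
      then have "{\<omega> \<in> space (M n). \<epsilon> < \<bar>X n \<omega> - c\<bar>} = {\<omega> \<in> space (M n). \<epsilon> < \<bar>Y n \<omega> - c\<bar>}"
        using assms by auto
      then show ?case by simp
    qed
  qed
  then show ?thesis by (simp add: tendsto_in_prob_def)
qed

lemma tendsto_in_prob_eventually:
  assumes "tendsto_in_prob M X c" "0 < \<epsilon>" "0 < \<delta>"
  shows "\<forall>\<^sub>F n in sequentially. measure (M n) {\<omega> \<in> space (M n). \<epsilon> < \<bar>X n \<omega> - c\<bar>} < \<delta>"
  using assms by (auto simp: tendsto_in_prob_def intro: order_tendstoD(2))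

text \<open>The common limiting argument: both the approximating sequence \<open>Y\<close> and its limit may depend on
  the accuracy, as a component size threshold or a truncation level does.\<close>

lemma tendsto_in_prob_approx:
  assumes prob: "\<And>n. 1 \<le> n \<Longrightarrow> prob_space (M n)"
    and approx: "\<And>\<epsilon> \<delta>. 0 < \<epsilon> \<Longrightarrow> 0 < \<delta> \<Longrightarrow> \<exists>Y c'. tendsto_in_prob M Y c' \<and>
      (\<forall>n\<ge>1. Y n \<in> borel_measurable (M n)) \<and> \<bar>c' - c\<bar> \<le> \<epsilon> \<and>
      (\<forall>\<^sub>F n in sequentially. \<exists>B\<in>sets (M n). measure (M n) B \<le> \<delta> \<and>
        (\<forall>\<omega>\<in>space (M n) - B. \<bar>X n \<omega> - Y n \<omega>\<bar> \<le> \<epsilon>))"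
  shows "tendsto_in_prob M X c"
  unfolding tendsto_in_prob_def
proof (intro allI impI)
  fix \<epsilon> :: real assume \<epsilon>: "0 < \<epsilon>"
  show "(\<lambda>n. measure (M n) {\<omega> \<in> space (M n). \<epsilon> < \<bar>X n \<omega> - c\<bar>}) \<longlonglongrightarrow> 0"
  proof (rule tendstoI)
    fix e :: real assume e: "0 < e"
    obtain Y c' where Y: "tendsto_in_prob M Y c'" and meas: "\<forall>n\<ge>1. Y n \<in> borel_measurable (M n)"
      and c': "\<bar>c' - c\<bar> \<le> \<epsilon> / 3"
      and ev: "\<forall>\<^sub>F n in sequentially. \<exists>B\<in>sets (M n). measure (M n) B \<le> e / 2 \<and>
        (\<forall>\<omega>\<in>space (M n) - B. \<bar>X n \<omega> - Y n \<omega>\<bar> \<le> \<epsilon> / 3)"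
      using approx[of "\<epsilon> / 3" "e / 2"] \<epsilon> e by auto
    have "\<forall>\<^sub>F n in sequentially.
        measure (M n) {\<omega> \<in> space (M n). \<epsilon> / 3 < \<bar>Y n \<omega> - c'\<bar>} < e / 2"
      using Y \<epsilon> e by (intro tendsto_in_prob_eventually) auto
    with ev eventually_ge_at_top[of 1]
    show "\<forall>\<^sub>F n in sequentially.
        dist (measure (M n) {\<omega> \<in> space (M n). \<epsilon> < \<bar>X n \<omega> - c\<bar>}) 0 < e"
    proof eventually_elim
      case (elim n)
      interpret prob_space "M n" using elim(2) by (rule prob)
      have [measurable]: "Y n \<in> borel_measurable (M n)" using meas elim(2) by blast
      obtain B where B: "B \<in> sets (M n)" "measure (M n) B \<le> e / 2"
        and close: "\<And>\<omega>. \<omega> \<in> space (M n) \<Longrightarrow> \<omega> \<notin> B \<Longrightarrow> \<bar>X n \<omega> - Y n \<omega>\<bar> \<le> \<epsilon> / 3"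
        using elim(1) by auto
      let ?D = "{\<omega> \<in> space (M n). \<epsilon> / 3 < \<bar>Y n \<omega> - c'\<bar>}"
      have D: "?D \<in> sets (M n)" by measurable
      have "{\<omega> \<in> space (M n). \<epsilon> < \<bar>X n \<omega> - c\<bar>} \<subseteq> B \<union> ?D"
      proof
        fix \<omega> assume \<omega>: "\<omega> \<in> {\<omega> \<in> space (M n). \<epsilon> < \<bar>X n \<omega> - c\<bar>}"
        have "\<epsilon> / 3 < \<bar>Y n \<omega> - c'\<bar>" if "\<omega> \<notin> B"
        proof -
          have "\<bar>X n \<omega> - Y n \<omega>\<bar> \<le> \<epsilon> / 3" "\<epsilon> < \<bar>X n \<omega> - c\<bar>" using close that \<omega> by simp_all
          then show ?thesis using c' by linarith
        qed
        then show "\<omega> \<in> B \<union> ?D" using \<omega> by auto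
      qed
      then have "measure (M n) {\<omega> \<in> space (M n). \<epsilon> < \<bar>X n \<omega> - c\<bar>} \<le> measure (M n) (B \<union> ?D)"
        using B(1) D by (intro finite_measure_mono) auto
      also have "\<dots> \<le> measure (M n) B + measure (M n) ?D"
        using B(1) D by (rule measure_Un_le)
      finally show ?case using B(2) elim(3) by (simp add: dist_real_def)
    qed
  qed
qed

lemma tendsto_in_prob_add:
  assumes prob: "\<And>n. 1 \<le> n \<Longrightarrow> prob_space (M n)"
    and X: "tendsto_in_prob M X c" "\<And>n. 1 \<le> n \<Longrightarrow> X n \<in> borel_measurable (M n)"
    and Y: "tendsto_in_prob M Y d" "\<And>n. 1 \<le> n \<Longrightarrow> Y n \<in> borel_measurable (M n)"
  shows "tendsto_in_prob M (\<lambda>n \<omega>. X n \<omega> + Y n \<omega>) (c + d)"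
proof (rule tendsto_in_prob_approx[OF prob])
  fix \<epsilon> \<delta> :: real assume pos: "0 < \<epsilon>" "0 < \<delta>"
  have "tendsto_in_prob M (\<lambda>n \<omega>. X n \<omega> + d) (c + d)"
    using X(1) by (simp add: tendsto_in_prob_def)
  moreover have "\<forall>n\<ge>1. (\<lambda>\<omega>. X n \<omega> + d) \<in> borel_measurable (M n)"
    using X(2) by (intro allI impI borel_measurable_add) auto
  moreover have "\<forall>\<^sub>F n in sequentially. \<exists>B\<in>sets (M n). measure (M n) B \<le> \<delta> \<and>
      (\<forall>\<omega>\<in>space (M n) - B. \<bar>X n \<omega> + Y n \<omega> - (X n \<omega> + d)\<bar> \<le> \<epsilon>)"
    using tendsto_in_prob_eventually[OF Y(1) pos] eventually_ge_at_top[of 1]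
  proof eventually_elim
    case (elim n)
    have [measurable]: "Y n \<in> borel_measurable (M n)" using Y(2) elim(2) by blast
    have "{\<omega> \<in> space (M n). \<epsilon> < \<bar>Y n \<omega> - d\<bar>} \<in> sets (M n)" by measurable
    then show ?case
      using elim(1) by (intro bexI[of _ "{\<omega> \<in> space (M n). \<epsilon> < \<bar>Y n \<omega> - d\<bar>}"] conjI) (auto simp: not_less)
  qed
  ultimately show "\<exists>Z c'. tendsto_in_prob M Z c' \<and> (\<forall>n\<ge>1. Z n \<in> borel_measurable (M n)) \<and>
      \<bar>c' - (c + d)\<bar> \<le> \<epsilon> \<and> (\<forall>\<^sub>F n in sequentially. \<exists>B\<in>sets (M n). measure (M n) B \<le> \<delta> \<and>
        (\<forall>\<omega>\<in>space (M n) - B. \<bar>X n \<omega> + Y n \<omega> - Z n \<omega>\<bar> \<le> \<epsilon>))"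
    using pos(1) by (intro exI[of _ "\<lambda>n \<omega>. X n \<omega> + d"] exI[of _ "c + d"] conjI) simp_all
qed

lemma tendsto_in_prob_cmult:
  assumes "tendsto_in_prob M X c"
  shows "tendsto_in_prob M (\<lambda>n \<omega>. a * X n \<omega>) (a * c)"
proof (cases "a = 0")
  case False
  have "\<epsilon> < \<bar>a * x - a * c\<bar> \<longleftrightarrow> \<epsilon> / \<bar>a\<bar> < \<bar>x - c\<bar>" for \<epsilon> x
  proof -
    have "\<bar>a * x - a * c\<bar> = \<bar>x - c\<bar> * \<bar>a\<bar>"
      by (metis abs_mult mult.commute right_diff_distrib)
    then show ?thesis using False by (simp only: pos_divide_less_eq zero_less_abs_iff not_False_eq_True)
  qed
  then show ?thesis using assms False by (simp add: tendsto_in_prob_def)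
qed (simp add: tendsto_in_prob_def)

lemma tendsto_in_prob_sum:
  assumes prob: "\<And>n. 1 \<le> n \<Longrightarrow> prob_space (M n)"
    and "finite I"
    and "\<And>i. i \<in> I \<Longrightarrow> tendsto_in_prob M (X i) (c i)"
    and "\<And>i n. i \<in> I \<Longrightarrow> 1 \<le> n \<Longrightarrow> X i n \<in> borel_measurable (M n)"
  shows "tendsto_in_prob M (\<lambda>n \<omega>. \<Sum>i\<in>I. X i n \<omega>) (\<Sum>i\<in>I. c i)"
  using assms(2-)
proof (induction I rule: finite_induct)
  case empty
  then show ?case by (simp add: tendsto_in_prob_def)
next
  case (insert i I)
  then show ?case
    by (simp, intro tendsto_in_prob_add[OF prob]) (auto intro!: borel_measurable_sum)
qed

text \<open>For large \<open>n\<close> the events that \<open>Y n\<close> is within \<open>1\<close> of its limit and that \<open>T n\<close> is at most \<open>t\<close>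
  have probabilities adding up to more than one, so they have a common point.\<close>

lemma tendsto_in_prob_upper_bound:
  assumes prob: "\<And>n. 1 \<le> n \<Longrightarrow> prob_space (M n)"
    and Y: "tendsto_in_prob M Y c" "\<And>n. 1 \<le> n \<Longrightarrow> Y n \<in> borel_measurable (M n)"
    and T: "\<And>n. 1 \<le> n \<Longrightarrow> T n \<in> borel_measurable (M n)"
    and le: "\<And>n \<omega>. 1 \<le> n \<Longrightarrow> \<omega> \<in> space (M n) \<Longrightarrow> Y n \<omega> \<le> T n \<omega>"
    and half: "\<And>n. 1 \<le> n \<Longrightarrow> measure (M n) {\<omega> \<in> space (M n). t < T n \<omega>} \<le> 1 / 2"
  shows "c \<le> t + 1"
proof -
  have "\<forall>\<^sub>F n in sequentially. measure (M n) {\<omega> \<in> space (M n). 1 < \<bar>Y n \<omega> - c\<bar>} < 1 / 2"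
    by (rule tendsto_in_prob_eventually[OF Y(1)]) auto
  then have "\<forall>\<^sub>F n in sequentially. measure (M n) {\<omega> \<in> space (M n). 1 < \<bar>Y n \<omega> - c\<bar>} < 1 / 2 \<and> 1 \<le> n"
    using eventually_ge_at_top[of 1] by (rule eventually_conj)
  then obtain n where n: "measure (M n) {\<omega> \<in> space (M n). 1 < \<bar>Y n \<omega> - c\<bar>} < 1 / 2" "1 \<le> n"
    by (auto dest: eventually_happens)
  interpret prob_space "M n" using n(2) by (rule prob)
  have [measurable]: "Y n \<in> borel_measurable (M n)" "T n \<in> borel_measurable (M n)"
    using Y(2) T n(2) by auto
  let ?A = "{\<omega> \<in> space (M n). 1 < \<bar>Y n \<omega> - c\<bar>}" and ?B = "{\<omega> \<in> space (M n). t < T n \<omega>}"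
  have "measure (M n) (?A \<union> ?B) \<le> measure (M n) ?A + measure (M n) ?B"
    by (rule measure_Un_le) measurable
  also have "\<dots> < 1" using n half[OF n(2)] by linarith
  finally have "?A \<union> ?B \<noteq> space (M n)" using prob_space by auto
  then obtain \<omega> where "\<omega> \<in> space (M n)" "\<not> 1 < \<bar>Y n \<omega> - c\<bar>" "\<not> t < T n \<omega>" by auto
  then show ?thesis using le[OF n(2), of \<omega>] by linarith
qed

section \<open>Frequencies of balls\<close>

definition ball_class :: "nat graph \<Rightarrow> nat \<Rightarrow> nat \<Rightarrow> rooted_class" where
  "ball_class K r v = rooted_class_of (graph_ball K v r, v)"

definition ball_freq :: "nat graph \<Rightarrow> nat \<Rightarrow> rooted_class set \<Rightarrow> real" where
  "ball_freq K r A = real (card {v \<in> verts K. ball_class K r v \<in> A}) / real (card (verts K))"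

lemma ball_freq_mono:
  assumes "finite (verts K)" "A \<subseteq> B"
  shows "ball_freq K r A \<le> ball_freq K r B"
  unfolding ball_freq_def
  by (intro divide_right_mono of_nat_mono card_mono) (use assms in auto)

lemma ball_freq_finite:
  assumes "finite (verts K)" "finite F"
  shows "ball_freq K r F = (\<Sum>H\<in>F. ball_freq K r {H})"
proof -
  have "{v \<in> verts K. ball_class K r v \<in> F} = (\<Union>H\<in>F. {v \<in> verts K. ball_class K r v \<in> {H}})"
    by auto
  then have "card {v \<in> verts K. ball_class K r v \<in> F}
      = (\<Sum>H\<in>F. card {v \<in> verts K. ball_class K r v \<in> {H}})"
    using assms by (simp only:) (rule card_UN_disjoint, auto)
  then show ?thesis by (simp add: ball_freq_def sum_divide_distrib)
qed

lemma ball_freq_Compl: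
  assumes "finite (verts K)" "verts K \<noteq> {}"
  shows "ball_freq K r (- A) = 1 - ball_freq K r A"
proof -
  have "{v \<in> verts K. ball_class K r v \<in> - A} = verts K - {v \<in> verts K. ball_class K r v \<in> A}"
    by auto
  then have "card {v \<in> verts K. ball_class K r v \<in> - A}
      = card (verts K) - card {v \<in> verts K. ball_class K r v \<in> A}"
    using assms(1) by (simp only:) (rule card_Diff_subset, auto)
  moreover have "card {v \<in> verts K. ball_class K r v \<in> A} \<le> card (verts K)"
    using assms(1) by (intro card_mono) auto
  ultimately show ?thesis using assms by (simp add: ball_freq_def field_simps of_nat_diff)
qed

lemma
  assumes "simple_graph K" "finite (verts K)" "v \<in> verts K"
  shows root_size_ball_class:
      "k \<le> root_size (ball_class K k v) \<longleftrightarrow> k \<le> card (verts (component K v))"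
    and root_degree_ball_class: "1 \<le> r \<Longrightarrow> root_degree (ball_class K r v) = degree K v"
proof -
  have lf: "locally_finite K" using assms(1,2) by (rule locally_finite_if_finite)
  have ball: "(graph_ball K v r, v) \<in> rooted_graphs" for r
    by (rule graph_ball_rooted[OF assms(1) lf assms(3)])
  have "finite (verts (component K v))" by (rule finite_subset[OF component_subset assms(2)])
  then show "k \<le> root_size (ball_class K k v) \<longleftrightarrow> k \<le> card (verts (component K v))"
    unfolding ball_class_def root_size_class[OF ball] graph_ball_size_iff[OF assms(1) lf assms(3)]
    by simp
  show "root_degree (ball_class K r v) = degree K v" if "1 \<le> r"
    unfolding ball_class_def root_degree_class[OF ball]
    by (rule degree_graph_ball[OF assms(1,3) that])
qed

locale random_graphs =
  fixes M :: "nat \<Rightarrow> 'w measure" and G :: "nat \<Rightarrow> 'w \<Rightarrow> nat graph"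
  assumes prob: "\<And>n. 1 \<le> n \<Longrightarrow> prob_space (M n)"
    and random_graph: "\<And>n. 1 \<le> n \<Longrightarrow> is_random_graph n (M n) (G n)"
begin

lemma graph:
  assumes "1 \<le> n" "\<omega> \<in> space (M n)"
  shows "simple_graph (G n \<omega>)" "finite (verts (G n \<omega>))" "card (verts (G n \<omega>)) = n"
  using measurable_space[OF random_graph[OF assms(1), unfolded is_random_graph_def] assms(2)]
  by auto

lemma measurable_graph:
  assumes "1 \<le> n"
  shows "(\<lambda>\<omega>. f (G n \<omega>) :: real) \<in> borel_measurable (M n)"
  by (rule measurable_compose[OF random_graph[OF assms, unfolded is_random_graph_def]]) simp

text \<open>Local convergence speaks of single classes; finitely many of them carry almost all of the
  mass of a set of classes.\<close>

lemma ball_freq_lower: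
  assumes mu: "prob_space \<mu>" "sets \<mu> = sets local_algebra"
    and conv: "locally_converges_in_prob M G \<mu>" and pos: "0 < \<epsilon>" "0 < \<delta>"
  shows "\<forall>\<^sub>F n in sequentially. measure (M n) {\<omega> \<in> space (M n).
      ball_freq (G n \<omega>) r A < measure \<mu> {c. root_ball r c \<in> A} - \<epsilon>} < \<delta>"
proof -
  interpret mu: prob_space \<mu> by (rule mu(1))
  \<comment> \<open>An enumeration of the classes that occur as balls of radius \<open>r\<close> exhausts the mass of \<open>A\<close> by
    finite pieces.\<close>
  define f where "f = from_nat_into (range (root_ball r))"
  have f: "range f = range (root_ball r)"
    unfolding f_def by (rule range_from_nat_into) (use countable_range_root_ball in auto)
  define S where "S N = {c. root_ball r c \<in> A \<inter> f ` {..N}}" for N :: nat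
  have "(\<lambda>N. measure \<mu> (S N)) \<longlonglongrightarrow> measure \<mu> (\<Union>N. S N)"
  proof (rule mu.finite_Lim_measure_incseq)
    show "range S \<subseteq> sets \<mu>" unfolding S_def using root_ball_vimage_sets[OF mu(2)] by blast
    show "incseq S" by (auto simp: S_def incseq_def)
  qed
  moreover have "\<exists>N. root_ball r c \<in> f ` {..N}" for c
    using f by (metis atMost_iff imageI order_refl rangeE rangeI)
  then have "(\<Union>N. S N) = {c. root_ball r c \<in> A}" unfolding S_def by blast
  ultimately have "\<forall>\<^sub>F N in sequentially.
      measure \<mu> {c. root_ball r c \<in> A} - \<epsilon> / 2 < measure \<mu> (S N)"
    using pos by (intro order_tendstoD(1)) auto
  then obtain N where N: "measure \<mu> {c. root_ball r c \<in> A} - \<epsilon> / 2 < measure \<mu> (S N)"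
    by (auto dest: eventually_happens)
  define F where "F = A \<inter> f ` {..N}"
  have F: "finite F" "F \<subseteq> A" by (auto simp: F_def)
  have "tendsto_in_prob M (\<lambda>n \<omega>. ball_freq (G n \<omega>) r {H}) (measure \<mu> {c. root_ball r c = H})" for H
  proof -
    have "ball_freq (G n \<omega>) r {H} = (\<Sum>v\<in>verts (G n \<omega>).
        of_bool (rooted_class_of (graph_ball (G n \<omega>) v r, v) = H)) / real (card (verts (G n \<omega>)))"
      if "1 \<le> n" "\<omega> \<in> space (M n)" for n \<omega>
      using graph(2)[OF that] by (simp add: ball_freq_def ball_class_def Int_def)
    then show ?thesis
      using conv unfolding locally_converges_in_prob_def
      by (subst tendsto_in_prob_cong) auto
  qed
  then have "tendsto_in_prob M (\<lambda>n \<omega>. \<Sum>H\<in>F. ball_freq (G n \<omega>) r {H})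
      (\<Sum>H\<in>F. measure \<mu> {c. root_ball r c = H})"
    by (intro tendsto_in_prob_sum prob F(1) measurable_graph) auto
  moreover have "measure \<mu> (S N) = (\<Sum>H\<in>F. measure \<mu> {c. root_ball r c = H})"
  proof -
    have "S N = (\<Union>H\<in>F. {c. root_ball r c = H})" by (auto simp: S_def F_def)
    moreover have "{c. root_ball r c = H} \<in> sets \<mu>" for H
      using root_ball_vimage_sets[OF mu(2), of r "{H}"] by simp
    ultimately show ?thesis
      using F(1) by (simp only:) (intro mu.finite_measure_finite_Union, auto simp: disjoint_family_on_def)
  qed
  ultimately have "\<forall>\<^sub>F n in sequentially. measure (M n)
      {\<omega> \<in> space (M n). \<epsilon> / 2 < \<bar>(\<Sum>H\<in>F. ball_freq (G n \<omega>) r {H}) - measure \<mu> (S N)\<bar>} < \<delta>"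
    using pos by (intro tendsto_in_prob_eventually) auto
  then show ?thesis
    using eventually_ge_at_top[of 1]
  proof eventually_elim
    case (elim n)
    interpret prob_space "M n" using elim(2) by (rule prob)
    note [measurable] = measurable_graph[OF elim(2)]
    have "\<epsilon> / 2 < \<bar>(\<Sum>H\<in>F. ball_freq (G n \<omega>) r {H}) - measure \<mu> (S N)\<bar>"
      if "\<omega> \<in> space (M n)" "ball_freq (G n \<omega>) r A < measure \<mu> {c. root_ball r c \<in> A} - \<epsilon>" for \<omega>
    proof -
      have fin: "finite (verts (G n \<omega>))" using graph(2) elim(2) that(1) .
      have "(\<Sum>H\<in>F. ball_freq (G n \<omega>) r {H}) \<le> ball_freq (G n \<omega>) r A"
        using ball_freq_mono[OF fin F(2)] by (simp only: ball_freq_finite[OF fin F(1)])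
      then show ?thesis using that(2) N by linarith
    qed
    then have "measure (M n) {\<omega> \<in> space (M n).
        ball_freq (G n \<omega>) r A < measure \<mu> {c. root_ball r c \<in> A} - \<epsilon>}
      \<le> measure (M n) {\<omega> \<in> space (M n).
        \<epsilon> / 2 < \<bar>(\<Sum>H\<in>F. ball_freq (G n \<omega>) r {H}) - measure \<mu> (S N)\<bar>}"
      by (intro finite_measure_mono) auto
    then show ?case using elim(1) by linarith
  qed
qed

text \<open>The frequencies of a set and of its complement add up to one, so a lower bound for one is an
  upper bound for the other.\<close>

lemma ball_freq_tendsto:
  assumes mu: "prob_space \<mu>" "sets \<mu> = sets local_algebra"
    and conv: "locally_converges_in_prob M G \<mu>"
  shows "tendsto_in_prob M (\<lambda>n \<omega>. ball_freq (G n \<omega>) r A) (measure \<mu> {c. root_ball r c \<in> A})"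
    (is "tendsto_in_prob M ?X ?p")
proof (rule tendsto_in_prob_approx[OF prob])
  interpret mu: prob_space \<mu> by (rule mu(1))
  fix \<epsilon> \<delta> :: real assume pos: "0 < \<epsilon>" "0 < \<delta>"
  have space_mu: "space \<mu> = UNIV"
    using sets_eq_imp_space_eq[OF mu(2)] by (simp add: local_algebra_def)
  have compl: "measure \<mu> {c. root_ball r c \<in> - A} = 1 - ?p"
    using mu.prob_compl[OF root_ball_vimage_sets[OF mu(2), of r A]]
    by (simp add: space_mu Compl_eq_Diff_UNIV[symmetric] Collect_neg_eq[symmetric])
  define B where "B n = {\<omega> \<in> space (M n). ?X n \<omega> < ?p - \<epsilon>} \<union>
    {\<omega> \<in> space (M n). ball_freq (G n \<omega>) r (- A) < measure \<mu> {c. root_ball r c \<in> - A} - \<epsilon>}" for n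
  have "\<forall>\<^sub>F n in sequentially. \<exists>B\<in>sets (M n). measure (M n) B \<le> \<delta> \<and>
      (\<forall>\<omega>\<in>space (M n) - B. \<bar>?X n \<omega> - ?p\<bar> \<le> \<epsilon>)"
    using ball_freq_lower[OF mu conv pos(1) half_gt_zero[OF pos(2)], of r A]
      ball_freq_lower[OF mu conv pos(1) half_gt_zero[OF pos(2)], of r "- A"]
      eventually_ge_at_top[of 1]
  proof eventually_elim
    case (elim n)
    note [measurable] = measurable_graph[OF elim(3)]
    have "measure (M n) (B n) \<le> \<delta> / 2 + \<delta> / 2"
      unfolding B_def
      by (rule order_trans[OF measure_Un_le add_mono]) (use elim(1,2) in auto)
    moreover have "\<bar>?X n \<omega> - ?p\<bar> \<le> \<epsilon>" if "\<omega> \<in> space (M n) - B n" for \<omega>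
    proof -
      have "verts (G n \<omega>) \<noteq> {}" using graph[of n \<omega>] that elim(3) by auto
      then have "ball_freq (G n \<omega>) r (- A) = 1 - ?X n \<omega>"
        using graph[of n \<omega>] that elim(3) by (intro ball_freq_Compl) auto
      then show ?thesis using that compl by (auto simp: B_def)
    qed
    moreover have "B n \<in> sets (M n)" unfolding B_def by measurable
    ultimately show ?case by auto
  qed
  moreover have "tendsto_in_prob M (\<lambda>n \<omega>. ?p) ?p" by (simp add: tendsto_in_prob_def)
  ultimately show "\<exists>Y c'. tendsto_in_prob M Y c' \<and> (\<forall>n\<ge>1. Y n \<in> borel_measurable (M n)) \<and>
      \<bar>c' - ?p\<bar> \<le> \<epsilon> \<and> (\<forall>\<^sub>F n in sequentially. \<exists>B\<in>sets (M n). measure (M n) B \<le> \<delta> \<and>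
        (\<forall>\<omega>\<in>space (M n) - B. \<bar>?X n \<omega> - Y n \<omega>\<bar> \<le> \<epsilon>))"
    using pos(1) by (intro exI[of _ "\<lambda>n \<omega>. ?p"] exI[of _ ?p] conjI) simp_all
qed

end

section \<open>The degree counts of the largest component\<close>

locale largest_component = random_graphs M G
  for M :: "nat \<Rightarrow> 'w measure" and G :: "nat \<Rightarrow> 'w \<Rightarrow> nat graph" +
  fixes Cmax :: "nat \<Rightarrow> 'w \<Rightarrow> nat graph" and \<mu> :: "rooted_class measure"
  assumes meas_Cmax: "\<And>n. 1 \<le> n \<Longrightarrow> Cmax n \<in> M n \<rightarrow>\<^sub>M count_space UNIV"
    and largest: "\<And>n \<omega>. 1 \<le> n \<Longrightarrow> \<omega> \<in> space (M n) \<Longrightarrow>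
      is_largest_component (G n \<omega>) (Cmax n \<omega>)"
    and prob_mu: "prob_space \<mu>" and sets_mu: "sets \<mu> = sets local_algebra"
    and local_conv: "locally_converges_in_prob M G \<mu>"
    and separated: "(\<lambda>k. limsup (\<lambda>n. ereal (1 / real n ^ 2 *
      (\<integral>\<omega>. real (card (separated_pairs (G n \<omega>) k)) \<partial>M n)))) \<longlonglongrightarrow> 0"
    and zeta_pos: "measure \<mu> {c. root_component_infinite c} > 0"
begin

sublocale mu: prob_space \<mu> by (rule prob_mu)

lemma measurable_Cmax:
  assumes "1 \<le> n"
  shows "(\<lambda>\<omega>. f (Cmax n \<omega>) :: real) \<in> borel_measurable (M n)"
  by (rule measurable_compose[OF meas_Cmax[OF assms]]) simp

lemma Cmax:
  assumes "1 \<le> n" "\<omega> \<in> space (M n)"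
  shows "simple_graph (Cmax n \<omega>)" "finite (verts (Cmax n \<omega>))" "verts (Cmax n \<omega>) \<subseteq> verts (G n \<omega>)"
    and "\<And>v. v \<in> verts (Cmax n \<omega>) \<Longrightarrow> degree (Cmax n \<omega>) v = degree (G n \<omega>) v"
proof -
  obtain a where C: "Cmax n \<omega> = component (G n \<omega>) a"
    using largest[OF assms] by (rule largest_component_cases)
  show "simple_graph (Cmax n \<omega>)"
    unfolding C by (rule simple_graph_component[OF graph(1)[OF assms]])
  show sub: "verts (Cmax n \<omega>) \<subseteq> verts (G n \<omega>)" unfolding C by (rule component_subset)
  show "finite (verts (Cmax n \<omega>))" by (rule finite_subset[OF sub graph(2)[OF assms]])
  show "degree (Cmax n \<omega>) v = degree (G n \<omega>) v" if "v \<in> verts (Cmax n \<omega>)" for v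
    using that unfolding C by (rule degree_component[OF graph(1)[OF assms]])
qed

text \<open>By \<open>root_size_root_ball_class\<close> these are the rooted graphs with at least \<open>k\<close> vertices,
  the infinite ones included.\<close>

abbreviation "large k \<equiv> {c. k \<le> root_size (root_ball k c)}"

lemma sets_large: "large k \<in> sets \<mu>"
  using root_ball_vimage_sets[OF sets_mu, of k "{H. k \<le> root_size H}"] by simp

lemma sets_root_degree: "{c. root_degree c = l} \<in> sets \<mu>"
  using root_ball_vimage_sets[OF sets_mu, of 1 "{H. root_degree H = l}"]
  by (simp add: root_degree_root_ball)

lemma infinite_eq_Inter_large: "{c. root_component_infinite c} = (\<Inter>k. large k)"
  by (auto simp: root_component_infinite_iff)

lemma sets_infinite: "{c. root_component_infinite c} \<in> sets \<mu>"
  unfolding infinite_eq_Inter_large using sets_large by blast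

lemma sets_infinite_degree: "{c. root_component_infinite c \<and> root_degree c = l} \<in> sets \<mu>"
  using sets.Int[OF sets_infinite sets_root_degree] by (simp add: Collect_conj_eq)

lemma measure_infinite_le_large:
  "measure \<mu> {c. root_component_infinite c} \<le> measure \<mu> (large k)"
  by (rule mu.finite_measure_mono[OF _ sets_large]) (auto simp: root_component_infinite_iff)

lemma measure_large_degree_tendsto:
  "(\<lambda>k. measure \<mu> (large k \<inter> {c. root_degree c = l}))
    \<longlonglongrightarrow> measure \<mu> {c. root_component_infinite c \<and> root_degree c = l}"
proof -
  have "(\<lambda>k. measure \<mu> (large k \<inter> {c. root_degree c = l}))
      \<longlonglongrightarrow> measure \<mu> (\<Inter>k. large k \<inter> {c. root_degree c = l})"
  proof (rule mu.finite_Lim_measure_decseq)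
    show "range (\<lambda>k. large k \<inter> {c. root_degree c = l}) \<subseteq> sets \<mu>"
      using sets.Int[OF sets_large sets_root_degree] by blast
    show "decseq (\<lambda>k. large k \<inter> {c. root_degree c = l})"
      unfolding decseq_def using root_size_root_ball_antimono by blast
  qed
  moreover have "(\<Inter>k. large k \<inter> {c. root_degree c = l})
      = {c. root_component_infinite c \<and> root_degree c = l}"
    by (auto simp: root_component_infinite_iff)
  ultimately show ?thesis by simp
qed

lemma large_verts_tendsto:
  "tendsto_in_prob M (\<lambda>n \<omega>. real (card (large_verts (G n \<omega>) k)) / real n) (measure \<mu> (large k))"
proof -
  have "real (card (large_verts (G n \<omega>) k)) / real n = ball_freq (G n \<omega>) k {H. k \<le> root_size H}"
    if "1 \<le> n" "\<omega> \<in> space (M n)" for n \<omega>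
  proof -
    have "{v \<in> verts (G n \<omega>). ball_class (G n \<omega>) k v \<in> {H. k \<le> root_size H}} = large_verts (G n \<omega>) k"
      using root_size_ball_class[OF graph(1,2)[OF that]] by (auto simp: large_verts_def)
    then show ?thesis using graph(3)[OF that] by (simp add: ball_freq_def)
  qed
  then show ?thesis
    using ball_freq_tendsto[OF prob_mu sets_mu local_conv, of k "{H. k \<le> root_size H}"]
    by (subst tendsto_in_prob_cong) auto
qed

text \<open>A ball of positive radius shows the degree of its centre as well, whence \<open>1 \<le> k\<close>.\<close>

lemma large_degree_tendsto:
  assumes "1 \<le> k"
  shows "tendsto_in_prob M
    (\<lambda>n \<omega>. real (card {v \<in> large_verts (G n \<omega>) k. degree (G n \<omega>) v = l}) / real n)
    (measure \<mu> (large k \<inter> {c. root_degree c = l}))"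
proof -
  let ?A = "{H. k \<le> root_size H \<and> root_degree H = l}"
  have "real (card {v \<in> large_verts (G n \<omega>) k. degree (G n \<omega>) v = l}) / real n
      = ball_freq (G n \<omega>) k ?A"
    if "1 \<le> n" "\<omega> \<in> space (M n)" for n \<omega>
  proof -
    have "{v \<in> verts (G n \<omega>). ball_class (G n \<omega>) k v \<in> ?A}
        = {v \<in> large_verts (G n \<omega>) k. degree (G n \<omega>) v = l}"
      using root_size_ball_class[OF graph(1,2)[OF that]]
        root_degree_ball_class[OF graph(1,2)[OF that] _ assms] by (auto simp: large_verts_def)
    then show ?thesis using graph(3)[OF that] by (simp add: ball_freq_def)
  qed
  moreover have "{c. root_ball k c \<in> ?A} = large k \<inter> {c. root_degree c = l}"
    using root_degree_root_ball[OF assms] by auto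
  ultimately show ?thesis
    using ball_freq_tendsto[OF prob_mu sets_mu local_conv, of k ?A]
    by (subst tendsto_in_prob_cong) auto
qed

lemma separated_pairs_Markov:
  assumes "1 \<le> n" "0 < a"
  shows "measure (M n) {\<omega> \<in> space (M n). a * real n ^ 2 \<le> real (card (separated_pairs (G n \<omega>) k))}
    \<le> 1 / real n ^ 2 * (\<integral>\<omega>. real (card (separated_pairs (G n \<omega>) k)) \<partial>M n) / a"
proof -
  interpret prob_space "M n" using assms(1) by (rule prob)
  have "integrable (M n) (\<lambda>\<omega>. real (card (separated_pairs (G n \<omega>) k)))"
  proof (rule integrable_const_bound[of _ "real n ^ 2"])
    have "real (card (separated_pairs (G n \<omega>) k)) \<le> real n ^ 2" if "\<omega> \<in> space (M n)" for \<omega>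
      using card_separated_pairs_le[of "G n \<omega>" k] graph[OF assms(1) that]
      by (metis of_nat_le_iff of_nat_power)
    then show "AE \<omega> in M n. norm (real (card (separated_pairs (G n \<omega>) k))) \<le> real n ^ 2"
      by (intro AE_I2) simp
  qed (rule measurable_graph[OF assms(1)])
  from integral_Markov_inequality_measure[OF this sets.empty_sets]
  have "measure (M n) {\<omega> \<in> space (M n). a * real n ^ 2 \<le> real (card (separated_pairs (G n \<omega>) k))}
    \<le> (\<integral>\<omega>. real (card (separated_pairs (G n \<omega>) k)) \<partial>M n) / (a * real n ^ 2)"
    using assms by simp
  then show ?thesis by (simp add: mult.commute)
qed

text \<open>The thresholds fit together: \<open>Z (Z - |C|) \<le> N\<close> and \<open>Z \<ge> z n\<close> give \<open>Z - |C| \<le> \<epsilon> n\<close> when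
  \<open>N \<le> z \<epsilon> n\<^sup>2\<close>. The two counts differ by at most \<open>Z - |C|\<close> because \<open>C\<close> consists of large
  vertices.\<close>

lemma degree_count_close:
  assumes n: "1 \<le> n" and \<omega>: "\<omega> \<in> space (M n)" and pos: "0 < z" "0 < \<epsilon>"
    and Z: "z * real n \<le> real (card (large_verts (G n \<omega>) k))"
    and N: "real (card (separated_pairs (G n \<omega>) k)) \<le> z * \<epsilon> * real n ^ 2"
  shows "\<bar>real (card {v \<in> verts (Cmax n \<omega>). degree (Cmax n \<omega>) v = l}) / real n
    - real (card {v \<in> large_verts (G n \<omega>) k. degree (G n \<omega>) v = l}) / real n\<bar> \<le> \<epsilon>"
proof -
  let ?Z = "large_verts (G n \<omega>) k" and ?C = "verts (Cmax n \<omega>)"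
  let ?A = "{v \<in> ?C. degree (Cmax n \<omega>) v = l}" and ?B = "{v \<in> ?Z. degree (G n \<omega>) v = l}"
  have npos: "0 < real n" using n by simp
  have finZ: "finite ?Z" using graph(2)[OF n \<omega>] by (simp add: large_verts_def)
  have "0 < real (card ?Z)" using mult_pos_pos[OF pos(1) npos] Z by linarith
  then have "?Z \<noteq> {}" by auto
  then have sub: "?C \<subseteq> ?Z"
    using largest_component_subset_large_verts[OF graph(1) largest] n \<omega> by blast
  have card_le: "card ?C \<le> card ?Z" by (rule card_mono[OF finZ sub])
  have "z * real n * (real (card ?Z) - real (card ?C))
      \<le> real (card ?Z) * (real (card ?Z) - real (card ?C))"
    using Z card_le by (intro mult_right_mono) auto
  also have "\<dots> = real (card ?Z * (card ?Z - card ?C))" using card_le by (simp add: of_nat_diff)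
  also have "\<dots> \<le> real (card (separated_pairs (G n \<omega>) k))"
    using separated_pairs_lower_bound[OF graph(1,2)[OF n \<omega>] largest[OF n \<omega>]] of_nat_le_iff by blast
  also have "\<dots> \<le> z * real n * (\<epsilon> * real n)" using N by (simp add: power2_eq_square mult_ac)
  finally have diff: "real (card ?Z) - real (card ?C) \<le> \<epsilon> * real n"
    by (rule mult_left_le_imp_le) (use pos npos in simp)
  have AB: "?A \<subseteq> ?B" using sub Cmax(4)[OF n \<omega>] by auto
  have finB: "finite ?B" using finZ by simp
  have "card ?B - card ?A = card (?B - ?A)"
    using AB finite_subset[OF AB finB] by (simp add: card_Diff_subset)
  also have "\<dots> \<le> card (?Z - ?C)"
    using finZ Cmax(4)[OF n \<omega>] by (intro card_mono) auto
  also have "\<dots> = card ?Z - card ?C" using sub Cmax(2)[OF n \<omega>] by (simp add: card_Diff_subset)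
  finally have "real (card ?B) - real (card ?A) \<le> \<epsilon> * real n"
    using diff card_le card_mono[OF finB AB] by linarith
  moreover have "real (card ?A) \<le> real (card ?B)" using card_mono[OF finB AB] by simp
  ultimately have "\<bar>real (card ?A) - real (card ?B)\<bar> \<le> \<epsilon> * real n" by linarith
  then have "\<bar>(real (card ?A) - real (card ?B)) / real n\<bar> \<le> \<epsilon>"
    using npos by (simp add: abs_divide pos_divide_le_eq)
  then show ?thesis by (simp add: diff_divide_distrib)
qed

text \<open>The radius \<open>k\<close> is chosen so large that the limit of the count in components of size at least
  \<open>k\<close> is close to the claimed one and separated pairs are rare; then \<open>n\<close> tends to infinity with \<open>k\<close>
  fixed.\<close>

lemma degree_count_tendsto:
  "tendsto_in_prob M
    (\<lambda>n \<omega>. real (card {v \<in> verts (Cmax n \<omega>). degree (Cmax n \<omega>) v = l}) / real n)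
    (measure \<mu> {c. root_component_infinite c \<and> root_degree c = l})"
    (is "tendsto_in_prob M ?X ?p")
proof (rule tendsto_in_prob_approx[OF prob])
  fix \<epsilon> \<delta> :: real assume pos: "0 < \<epsilon>" "0 < \<delta>"
  \<comment> \<open>The fraction of large vertices converges to at least \<open>2 * z\<close>, so it usually exceeds \<open>z\<close>.\<close>
  define z where "z = measure \<mu> {c. root_component_infinite c} / 2"
  have z: "0 < z" using zeta_pos by (simp add: z_def)
  let ?p = "measure \<mu> {c. root_component_infinite c \<and> root_degree c = l}"
  let ?q = "\<lambda>k. measure \<mu> (large k \<inter> {c. root_degree c = l})"
  let ?N = "\<lambda>k n \<omega>. real (card (separated_pairs (G n \<omega>) k))"
  have "0 < \<delta> / 2 * (z * \<epsilon>)" using pos z by simp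
  then have "\<forall>\<^sub>F k in sequentially. limsup (\<lambda>n. ereal (1 / real n ^ 2 * (\<integral>\<omega>. ?N k n \<omega> \<partial>M n)))
      < ereal (\<delta> / 2 * (z * \<epsilon>))"
    by (intro order_tendstoD(2)[OF separated]) simp
  moreover have "\<forall>\<^sub>F k in sequentially. dist (?q k) ?p < \<epsilon>"
    by (rule tendstoD[OF measure_large_degree_tendsto pos(1)])
  ultimately have "\<forall>\<^sub>F k in sequentially.
      limsup (\<lambda>n. ereal (1 / real n ^ 2 * (\<integral>\<omega>. ?N k n \<omega> \<partial>M n))) < ereal (\<delta> / 2 * (z * \<epsilon>)) \<and>
      dist (?q k) ?p < \<epsilon> \<and> 1 \<le> k"
    using eventually_ge_at_top[of 1] by (simp add: eventually_conj_iff)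
  then obtain k where k: "1 \<le> k" and q: "dist (?q k) ?p < \<epsilon>"
    and lim: "limsup (\<lambda>n. ereal (1 / real n ^ 2 * (\<integral>\<omega>. ?N k n \<omega> \<partial>M n))) < ereal (\<delta> / 2 * (z * \<epsilon>))"
    by (auto dest: eventually_happens)
  let ?Z = "\<lambda>n \<omega>. real (card (large_verts (G n \<omega>) k))"
  define B where "B n = {\<omega> \<in> space (M n). z < \<bar>?Z n \<omega> / real n - measure \<mu> (large k)\<bar>} \<union>
    {\<omega> \<in> space (M n). z * \<epsilon> * real n ^ 2 \<le> ?N k n \<omega>}" for n
  let ?Y = "\<lambda>n \<omega>. real (card {v \<in> large_verts (G n \<omega>) k. degree (G n \<omega>) v = l}) / real n"
  have "\<forall>\<^sub>F n in sequentially. \<exists>B\<in>sets (M n). measure (M n) B \<le> \<delta> \<and>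
      (\<forall>\<omega>\<in>space (M n) - B. \<bar>?X n \<omega> - ?Y n \<omega>\<bar> \<le> \<epsilon>)"
    using tendsto_in_prob_eventually[OF large_verts_tendsto[of k] z half_gt_zero[OF pos(2)]]
      Limsup_lessD[OF lim] eventually_ge_at_top[of 1]
  proof eventually_elim
    case (elim n)
    note [measurable] = measurable_graph[OF elim(3)]
    have "measure (M n) {\<omega> \<in> space (M n). z * \<epsilon> * real n ^ 2 \<le> ?N k n \<omega>}
        \<le> 1 / real n ^ 2 * (\<integral>\<omega>. ?N k n \<omega> \<partial>M n) / (z * \<epsilon>)"
      by (rule separated_pairs_Markov[OF elim(3)]) (use pos z in simp)
    also have "\<dots> \<le> \<delta> / 2"
    proof (rule mult_imp_div_pos_le)
      show "0 < z * \<epsilon>" using pos z by simp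
      show "1 / real n ^ 2 * (\<integral>\<omega>. ?N k n \<omega> \<partial>M n) \<le> \<delta> / 2 * (z * \<epsilon>)"
        using elim(2) by (simp only: less_ereal.simps less_imp_le)
    qed
    finally have "measure (M n) {\<omega> \<in> space (M n). z * \<epsilon> * real n ^ 2 \<le> ?N k n \<omega>} \<le> \<delta> / 2" .
    moreover have "measure (M n) (B n)
        \<le> measure (M n) {\<omega> \<in> space (M n). z < \<bar>?Z n \<omega> / real n - measure \<mu> (large k)\<bar>}
          + measure (M n) {\<omega> \<in> space (M n). z * \<epsilon> * real n ^ 2 \<le> ?N k n \<omega>}"
      unfolding B_def by (rule measure_Un_le) measurable
    ultimately have "measure (M n) (B n) \<le> \<delta>" using elim(1) by linarith
    moreover have "\<bar>?X n \<omega> - ?Y n \<omega>\<bar> \<le> \<epsilon>" if "\<omega> \<in> space (M n) - B n" for \<omega>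
    proof (rule degree_count_close[OF elim(3) _ z pos(1)])
      have "z \<le> ?Z n \<omega> / real n"
      proof -
        have "\<not> z < \<bar>?Z n \<omega> / real n - measure \<mu> (large k)\<bar>" using that by (simp add: B_def)
        moreover have "2 * z \<le> measure \<mu> (large k)"
          using measure_infinite_le_large[of k] by (simp add: z_def)
        ultimately show ?thesis by linarith
      qed
      then show "z * real n \<le> ?Z n \<omega>" using elim(3) by (simp add: pos_le_divide_eq)
      show "\<omega> \<in> space (M n)" "?N k n \<omega> \<le> z * \<epsilon> * real n ^ 2" using that by (auto simp: B_def)
    qed
    moreover have "B n \<in> sets (M n)" unfolding B_def by measurable
    ultimately show ?case by (intro bexI[of _ "B n"] conjI) auto
  qed
  moreover have "\<forall>n\<ge>1. ?Y n \<in> borel_measurable (M n)"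
    by (intro allI impI measurable_graph)
  ultimately show "\<exists>Y c'. tendsto_in_prob M Y c' \<and> (\<forall>n\<ge>1. Y n \<in> borel_measurable (M n)) \<and>
      \<bar>c' - ?p\<bar> \<le> \<epsilon> \<and> (\<forall>\<^sub>F n in sequentially. \<exists>B\<in>sets (M n). measure (M n) B \<le> \<delta> \<and>
        (\<forall>\<omega>\<in>space (M n) - B. \<bar>?X n \<omega> - Y n \<omega>\<bar> \<le> \<epsilon>))"
    using large_degree_tendsto[OF k, of l] q
    by (intro exI[of _ ?Y] exI[of _ "?q k"] conjI) (simp_all add: dist_real_def)
qed

end

section \<open>Truncating the degrees\<close>

text \<open>This is \<open>E[D 1{D > L}]\<close> for the degree \<open>D\<close> of a uniform vertex of \<open>K\<close>.\<close>

definition degree_tail :: "nat graph \<Rightarrow> nat \<Rightarrow> real" where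
  "degree_tail K L =
    (\<Sum>v\<in>verts K. if L < degree K v then real (degree K v) else 0) / real (card (verts K))"

lemma sum_by_value:
  fixes d :: "'v \<Rightarrow> nat"
  assumes "finite V" "finite S"
  shows "(\<Sum>l\<in>S. real l * real (card {v \<in> V. d v = l})) = (\<Sum>v\<in>V. if d v \<in> S then real (d v) else 0)"
proof -
  have "(\<Sum>l\<in>S. real l * real (card {v \<in> V. d v = l})) = (\<Sum>l\<in>S. \<Sum>v\<in>V. if d v = l then real l else 0)"
    using assms(1) by (intro sum.cong refl) (simp add: sum.If_cases Int_def mult.commute)
  also have "\<dots> = (\<Sum>v\<in>V. \<Sum>l\<in>S. if d v = l then real l else 0)" by (rule sum.swap)
  also have "\<dots> = (\<Sum>v\<in>V. if d v \<in> S then real (d v) else 0)"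
    using assms(2) by (intro sum.cong refl) simp
  finally show ?thesis .
qed

context random_graphs
begin

lemma nn_integral_uniform_root_law:
  assumes "1 \<le> n"
  shows "(\<integral>\<^sup>+x. f x \<partial>uniform_root_law (M n) (G n))
    = (\<integral>\<^sup>+\<omega>. (\<Sum>v\<in>verts (G n \<omega>). f (G n \<omega>, v)) / ennreal (real n) \<partial>M n)"
proof -
  have G: "G n \<in> M n \<rightarrow>\<^sub>M count_space UNIV"
    by (rule measurable_compose[OF random_graph[OF assms, unfolded is_random_graph_def],
          of "\<lambda>K. K"]) simp
  have "(\<integral>\<^sup>+x. f x \<partial>uniform_root_law (M n) (G n))
      = (\<integral>\<^sup>+\<omega>. \<integral>\<^sup>+x. f x \<partial>measure_pmf (map_pmf (\<lambda>v. (G n \<omega>, v)) (pmf_of_set (verts (G n \<omega>)))) \<partial>M n)"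
    unfolding uniform_root_law_def
    by (rule nn_integral_bind[where B = "count_space UNIV"])
      (simp, rule measurable_compose[OF G measurable_measure_pmf])
  also have "\<dots> = (\<integral>\<^sup>+\<omega>. (\<Sum>v\<in>verts (G n \<omega>). f (G n \<omega>, v)) / ennreal (real n) \<partial>M n)"
  proof (rule nn_integral_cong)
    fix \<omega> assume "\<omega> \<in> space (M n)"
    note K = graph[OF assms this]
    then have "verts (G n \<omega>) \<noteq> {}" using assms by auto
    then show "(\<integral>\<^sup>+x. f x \<partial>measure_pmf (map_pmf (\<lambda>v. (G n \<omega>, v)) (pmf_of_set (verts (G n \<omega>)))))
        = (\<Sum>v\<in>verts (G n \<omega>). f (G n \<omega>, v)) / ennreal (real n)"
      using K by (simp add: nn_integral_pmf_of_set ennreal_of_nat_eq_real_of_nat)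
  qed
  finally show ?thesis .
qed

lemma degree_tail_expectation:
  assumes ui: "uniformly_integrable {1..} (\<lambda>n. uniform_root_law (M n) (G n))
      (\<lambda>n (H, v). real (degree H v))"
    and "0 < \<delta>"
  shows "\<forall>\<^sub>F L in sequentially. \<forall>n\<ge>1. (\<integral>\<^sup>+\<omega>. ennreal (degree_tail (G n \<omega>) L) \<partial>M n) \<le> ennreal \<delta>"
proof -
  let ?D = "\<lambda>(H :: nat graph, v). real (degree H v)"
  let ?N = "\<lambda>n. uniform_root_law (M n) (G n)"
  have "((\<lambda>K::real. SUP n\<in>{1..}. \<integral>\<^sup>+x. ennreal \<bar>?D x\<bar> * indicator {x. K < \<bar>?D x\<bar>} x \<partial>?N n)
      \<longlongrightarrow> 0) at_top"
    using ui by (simp add: uniformly_integrable_def)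
  then have "((\<lambda>L. SUP n\<in>{1..}. \<integral>\<^sup>+x. ennreal \<bar>?D x\<bar> * indicator {x. real L < \<bar>?D x\<bar>} x \<partial>?N n)
      \<longlongrightarrow> 0) sequentially"
    by (rule filterlim_compose[OF _ filterlim_real_sequentially])
  then have "\<forall>\<^sub>F L in sequentially.
      (SUP n\<in>{1..}. \<integral>\<^sup>+x. ennreal \<bar>?D x\<bar> * indicator {x. real L < \<bar>?D x\<bar>} x \<partial>?N n) < ennreal \<delta>"
    by (rule order_tendstoD(2)) (use assms(2) in simp)
  then show ?thesis
  proof eventually_elim
    case (elim L)
    show ?case
    proof (intro allI impI)
      fix n :: nat assume n: "1 \<le> n"
      have "(\<integral>\<^sup>+\<omega>. ennreal (degree_tail (G n \<omega>) L) \<partial>M n)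
          = (\<integral>\<^sup>+\<omega>. (\<Sum>v\<in>verts (G n \<omega>). ennreal \<bar>?D (G n \<omega>, v)\<bar> *
              indicator {x. real L < \<bar>?D x\<bar>} (G n \<omega>, v)) / ennreal (real n) \<partial>M n)"
      proof (rule nn_integral_cong)
        fix \<omega> assume \<omega>: "\<omega> \<in> space (M n)"
        let ?V = "verts (G n \<omega>)" and ?d = "degree (G n \<omega>)"
        have "(\<Sum>v\<in>?V. ennreal \<bar>?D (G n \<omega>, v)\<bar> * indicator {x. real L < \<bar>?D x\<bar>} (G n \<omega>, v))
            = (\<Sum>v\<in>?V. ennreal (if L < ?d v then real (?d v) else 0))"
          by (intro sum.cong refl) auto
        also have "\<dots> = ennreal (\<Sum>v\<in>?V. if L < ?d v then real (?d v) else 0)"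
          by (intro sum_ennreal) auto
        finally show "ennreal (degree_tail (G n \<omega>) L) = (\<Sum>v\<in>?V. ennreal \<bar>?D (G n \<omega>, v)\<bar> *
            indicator {x. real L < \<bar>?D x\<bar>} (G n \<omega>, v)) / ennreal (real n)"
          using n graph(3)[OF n \<omega>]
          by (simp only: degree_tail_def) (intro divide_ennreal[symmetric] sum_nonneg, auto)
      qed
      also have "\<dots> = (\<integral>\<^sup>+x. ennreal \<bar>?D x\<bar> * indicator {x. real L < \<bar>?D x\<bar>} x \<partial>?N n)"
        by (rule nn_integral_uniform_root_law[OF n, symmetric])
      also have "\<dots> \<le> (SUP n\<in>{1..}. \<integral>\<^sup>+x. ennreal \<bar>?D x\<bar> * indicator {x. real L < \<bar>?D x\<bar>} x \<partial>?N n)"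
        by (rule SUP_upper) (use n in simp)
      also have "\<dots> \<le> ennreal \<delta>" using elim by (rule less_imp_le)
      finally show "(\<integral>\<^sup>+\<omega>. ennreal (degree_tail (G n \<omega>) L) \<partial>M n) \<le> ennreal \<delta>" .
    qed
  qed
qed

lemma degree_tail_Markov:
  assumes n: "1 \<le> n" and t: "0 < t" "0 \<le> \<delta>"
    and le: "(\<integral>\<^sup>+\<omega>. ennreal (degree_tail (G n \<omega>) L) \<partial>M n) \<le> ennreal \<delta>"
  shows "measure (M n) {\<omega> \<in> space (M n). t < degree_tail (G n \<omega>) L} \<le> \<delta> / t"
proof -
  interpret prob_space "M n" using n by (rule prob)
  note [measurable] = measurable_graph[OF n]
  let ?B = "{\<omega> \<in> space (M n). t < degree_tail (G n \<omega>) L}"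
  have B: "?B \<in> sets (M n)" by measurable
  have "ennreal (t * measure (M n) ?B) = (\<integral>\<^sup>+\<omega>. ennreal t * indicator ?B \<omega> \<partial>M n)"
    using B t by (simp add: nn_integral_cmult_indicator emeasure_eq_measure ennreal_mult)
  also have "\<dots> \<le> (\<integral>\<^sup>+\<omega>. ennreal (degree_tail (G n \<omega>) L) \<partial>M n)"
    by (intro nn_integral_mono) (auto simp: indicator_def intro: ennreal_leI)
  also note le
  finally have "t * measure (M n) ?B \<le> \<delta>" using t by (simp add: ennreal_le_iff)
  then show ?thesis using t by (simp add: pos_le_divide_eq mult.commute)
qed

end

section \<open>The number of edges of the largest component\<close>

context largest_component
begin

abbreviation "degree_count l n \<omega> \<equiv> real (card {v \<in> verts (Cmax n \<omega>). degree (Cmax n \<omega>) v = l}) / real n"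

abbreviation "degree_prob l \<equiv> measure \<mu> {c. root_component_infinite c \<and> root_degree c = l}"

lemma weighted_degree_count_tendsto:
  assumes "finite S"
  shows "tendsto_in_prob M (\<lambda>n \<omega>. \<Sum>l\<in>S. real l / 2 * degree_count l n \<omega>)
    (\<Sum>l\<in>S. real l / 2 * degree_prob l)"
proof (rule tendsto_in_prob_sum[OF prob assms])
  show "tendsto_in_prob M (\<lambda>n \<omega>. real l / 2 * degree_count l n \<omega>) (real l / 2 * degree_prob l)" for l
    by (rule tendsto_in_prob_cmult[OF degree_count_tendsto])
  show "(\<lambda>\<omega>. real l / 2 * degree_count l n \<omega>) \<in> borel_measurable (M n)" if "1 \<le> n" for l n
    by (rule measurable_Cmax[OF that])
qed

lemma weighted_degree_count:
  assumes "1 \<le> n" "\<omega> \<in> space (M n)" "finite S"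
  shows "(\<Sum>l\<in>S. real l / 2 * degree_count l n \<omega>)
    = (\<Sum>v\<in>verts (Cmax n \<omega>). if degree (Cmax n \<omega>) v \<in> S then real (degree (Cmax n \<omega>) v) else 0)
      / (2 * real n)"
  unfolding sum_by_value[OF Cmax(2)[OF assms(1,2)] assms(3), symmetric] sum_divide_distrib
  by (intro sum.cong refl) simp

lemma component_tail_le:
  assumes n: "1 \<le> n" and \<omega>: "\<omega> \<in> space (M n)" and S: "\<And>d. d \<in> S \<Longrightarrow> L < d"
  shows "(\<Sum>v\<in>verts (Cmax n \<omega>). if degree (Cmax n \<omega>) v \<in> S then real (degree (Cmax n \<omega>) v) else 0)
    / (2 * real n) \<le> degree_tail (G n \<omega>) L"
proof -
  let ?C = "verts (Cmax n \<omega>)" and ?V = "verts (G n \<omega>)" and ?d = "degree (G n \<omega>)"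
  let ?g = "\<lambda>v. if L < ?d v then real (?d v) else 0"
  have "(\<Sum>v\<in>?C. if degree (Cmax n \<omega>) v \<in> S then real (degree (Cmax n \<omega>) v) else 0) \<le> (\<Sum>v\<in>?C. ?g v)"
    using Cmax(4)[OF n \<omega>] S by (intro sum_mono) auto
  also have "\<dots> \<le> (\<Sum>v\<in>?V. ?g v)"
    by (rule sum_mono2[OF graph(2)[OF n \<omega>] Cmax(3)[OF n \<omega>]]) simp
  finally have le: "(\<Sum>v\<in>?C. if degree (Cmax n \<omega>) v \<in> S then real (degree (Cmax n \<omega>) v) else 0)
      \<le> (\<Sum>v\<in>?V. ?g v)" .
  have nonneg: "0 \<le> (\<Sum>v\<in>?V. ?g v)" by (rule sum_nonneg) simp
  show ?thesis
    unfolding degree_tail_def graph(3)[OF n \<omega>]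
    by (rule frac_le[OF nonneg le]) (use n in simp_all)
qed

text \<open>By the handshake identity the edge count is half the sum of the degrees, and the truncated sum
  misses only the vertices of degree above \<open>L\<close>.\<close>

lemma edges_truncation:
  assumes n: "1 \<le> n" and \<omega>: "\<omega> \<in> space (M n)"
  shows "\<bar>real (card (edges (Cmax n \<omega>))) / real n - (\<Sum>l\<le>L. real l / 2 * degree_count l n \<omega>)\<bar>
    \<le> degree_tail (G n \<omega>) L"
proof -
  let ?C = "verts (Cmax n \<omega>)" and ?d = "degree (Cmax n \<omega>)"
  let ?r = "\<lambda>S. \<Sum>v\<in>?C. if ?d v \<in> S then real (?d v) else 0"
  have "2 * real (card (edges (Cmax n \<omega>))) = (\<Sum>v\<in>?C. real (?d v))"
    using handshake[OF Cmax(1,2)[OF n \<omega>]] by (metis of_nat_mult of_nat_numeral of_nat_sum)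
  also have "\<dots> = ?r {..L} + ?r {L<..}"
    unfolding sum.distrib[symmetric] by (intro sum.cong refl) auto
  finally have "real (card (edges (Cmax n \<omega>))) / real n = ?r {..L} / (2 * real n) + ?r {L<..} / (2 * real n)"
    using n by (simp add: field_simps)
  then have "real (card (edges (Cmax n \<omega>))) / real n - (\<Sum>l\<le>L. real l / 2 * degree_count l n \<omega>)
      = ?r {L<..} / (2 * real n)"
    using weighted_degree_count[OF n \<omega>, of "{..L}"] by simp
  moreover have "?r {L<..} / (2 * real n) \<le> degree_tail (G n \<omega>) L"
    by (rule component_tail_le[OF n \<omega>]) simp
  moreover have "0 \<le> ?r {L<..} / (2 * real n)" by (intro divide_nonneg_nonneg sum_nonneg) auto
  ultimately show ?thesis by (simp only: abs_of_nonneg)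
qed

text \<open>Beyond a level \<open>L0\<close> where the expected tail is at most \<open>1/2\<close>, every block of the series is the
  limit of quantities that are at most \<open>1\<close> with probability at least a half. So the partial sums,
  which increase, are bounded.\<close>

lemma degree_prob_convergent:
  assumes ui: "uniformly_integrable {1..} (\<lambda>n. uniform_root_law (M n) (G n))
      (\<lambda>n (H, v). real (degree H v))"
  shows "convergent (\<lambda>L. \<Sum>l\<le>L. real l / 2 * degree_prob l)"
proof -
  let ?c = "\<lambda>L. \<Sum>l\<le>L. real l / 2 * degree_prob l"
  obtain L0 where L0: "\<And>n. 1 \<le> n \<Longrightarrow>
      (\<integral>\<^sup>+\<omega>. ennreal (degree_tail (G n \<omega>) L0) \<partial>M n) \<le> ennreal (1 / 2)"
    using eventually_happens[OF degree_tail_expectation[OF ui, of "1 / 2"]] by auto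
  have mono: "incseq ?c" by (intro monoI sum_mono2) auto
  have bound: "?c L \<le> ?c L0 + 2" for L
  proof (cases "L0 \<le> L")
    case True
    have "(\<Sum>l\<in>{L0<..L}. real l / 2 * degree_prob l) \<le> 1 + 1"
    proof (rule tendsto_in_prob_upper_bound[OF prob weighted_degree_count_tendsto])
      show "(\<lambda>\<omega>. \<Sum>l\<in>{L0<..L}. real l / 2 * degree_count l n \<omega>) \<in> borel_measurable (M n)"
        if "1 \<le> n" for n
        by (rule measurable_Cmax[OF that])
      show "(\<lambda>\<omega>. degree_tail (G n \<omega>) L0) \<in> borel_measurable (M n)" if "1 \<le> n" for n
        by (rule measurable_graph[OF that])
      show "(\<Sum>l\<in>{L0<..L}. real l / 2 * degree_count l n \<omega>) \<le> degree_tail (G n \<omega>) L0"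
        if n: "1 \<le> n" and \<omega>: "\<omega> \<in> space (M n)" for n \<omega>
        unfolding weighted_degree_count[OF n \<omega> finite_greaterThanAtMost]
        by (rule component_tail_le[OF n \<omega>]) simp
      show "measure (M n) {\<omega> \<in> space (M n). 1 < degree_tail (G n \<omega>) L0} \<le> 1 / 2" if "1 \<le> n" for n
        using degree_tail_Markov[OF that _ _ L0[OF that], of 1] by simp
    qed auto
    moreover have "{..L} = {..L0} \<union> {L0<..L}" using True by auto
    then have "?c L = ?c L0 + (\<Sum>l\<in>{L0<..L}. real l / 2 * degree_prob l)"
      by (simp only:) (rule sum.union_disjoint, auto)
    ultimately show ?thesis by linarith
  next
    case False
    then have "?c L \<le> ?c L0" using mono by (simp add: incseq_def)
    then show ?thesis by linarith
  qed
  show ?thesis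
    by (rule incseq_convergent[OF mono allI[OF bound]]) (rule convergentI)
qed

text \<open>At each rooted graph the truncated sums increase and are constant once \<open>L\<close> reaches the root
  degree, so monotone convergence applies.\<close>

lemma
  assumes lim: "(\<lambda>L. \<Sum>l\<le>L. real l / 2 * degree_prob l) \<longlonglongrightarrow> c"
  shows integrable_root_degree:
      "integrable \<mu> (\<lambda>x. real (root_degree x) * indicator {x. root_component_infinite x} x)"
    and integral_root_degree:
      "(\<integral>x. real (root_degree x) * indicator {x. root_component_infinite x} x \<partial>\<mu>) = 2 * c"
proof -
  let ?E = "\<lambda>l. {x. root_component_infinite x \<and> root_degree x = l}"
  let ?u = "\<lambda>x. real (root_degree x) * indicator {x. root_component_infinite x} x :: real"
  let ?f = "\<lambda>L x. \<Sum>l\<le>L. real l * indicator (?E l) x :: real"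
  have int: "integrable \<mu> (?f L)" for L
    using sets_infinite_degree
    by (intro Bochner_Integration.integrable_sum integrable_mult_right integrable_real_indicator)
      (auto simp: mu.emeasure_eq_measure)
  have "\<forall>\<^sub>F L in sequentially. ?f L x = ?u x" for x
    using eventually_ge_at_top[of "root_degree x"]
  proof eventually_elim
    case (elim L)
    have "?f L x = (\<Sum>l\<le>L. if root_degree x = l then ?u x else 0)"
      by (intro sum.cong refl) (auto simp: indicator_def)
    then show ?case using elim by simp
  qed
  then have pointwise: "(\<lambda>L. ?f L x) \<longlonglongrightarrow> ?u x" for x by (rule tendsto_eventually)
  have "(\<lambda>L. integral\<^sup>L \<mu> (?f L)) = (\<lambda>L. 2 * (\<Sum>l\<le>L. real l / 2 * degree_prob l))"
  proof
    fix L
    have "integral\<^sup>L \<mu> (?f L) = (\<Sum>l\<le>L. real l * degree_prob l)"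
      using sets_infinite_degree
      by (subst Bochner_Integration.integral_sum) (auto simp: mu.emeasure_eq_measure)
    then show "integral\<^sup>L \<mu> (?f L) = 2 * (\<Sum>l\<le>L. real l / 2 * degree_prob l)"
      by (simp add: sum_distrib_left)
  qed
  then have ilim: "(\<lambda>L. integral\<^sup>L \<mu> (?f L)) \<longlonglongrightarrow> 2 * c"
    using tendsto_mult_left[OF lim, of 2] by simp
  have meas: "?u \<in> borel_measurable \<mu>"
    by (rule borel_measurable_LIMSEQ_real[OF pointwise borel_measurable_integrable[OF int]])
  have "mono (\<lambda>L. ?f L x)" for x by (intro monoI sum_mono2) auto
  then have "AE x in \<mu>. mono (\<lambda>L. ?f L x)" by (intro AE_I2)
  moreover have "AE x in \<mu>. 0 \<le> ?f L x" for L by (intro AE_I2 sum_nonneg) simp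
  moreover have "AE x in \<mu>. (\<lambda>L. ?f L x) \<longlonglongrightarrow> ?u x" using pointwise by (intro AE_I2)
  ultimately show "integrable \<mu> ?u" "integral\<^sup>L \<mu> ?u = 2 * c"
    using integral_monotone_convergence_nonneg[OF int _ _ _ ilim meas] by blast+
qed

text \<open>Uniform integrability controls the error of truncation in expectation, uniformly in \<open>n\<close>, so
  that Markov's inequality lets the truncated sums carry the limit.\<close>

lemma edge_count_tendsto:
  assumes ui: "uniformly_integrable {1..} (\<lambda>n. uniform_root_law (M n) (G n))
      (\<lambda>n (H, v). real (degree H v))"
    and lim: "(\<lambda>L. \<Sum>l\<le>L. real l / 2 * degree_prob l) \<longlonglongrightarrow> c"
  shows "tendsto_in_prob M (\<lambda>n \<omega>. real (card (edges (Cmax n \<omega>))) / real n) c"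
proof (rule tendsto_in_prob_approx[OF prob])
  fix \<epsilon> \<delta> :: real assume pos: "0 < \<epsilon>" "0 < \<delta>"
  let ?X = "\<lambda>n \<omega>. real (card (edges (Cmax n \<omega>))) / real n"
  let ?Y = "\<lambda>L n \<omega>. \<Sum>l\<le>L. real l / 2 * degree_count l n \<omega>"
  let ?c = "\<lambda>L. \<Sum>l\<le>L. real l / 2 * degree_prob l"
  have "\<forall>\<^sub>F L in sequentially.
      (\<forall>n\<ge>1. (\<integral>\<^sup>+\<omega>. ennreal (degree_tail (G n \<omega>) L) \<partial>M n) \<le> ennreal (\<delta> * \<epsilon>)) \<and> dist (?c L) c < \<epsilon>"
    using pos by (intro eventually_conj degree_tail_expectation[OF ui] tendstoD[OF lim]) simp_all
  then obtain L where close: "dist (?c L) c < \<epsilon>" and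
    tail: "\<And>n. 1 \<le> n \<Longrightarrow> (\<integral>\<^sup>+\<omega>. ennreal (degree_tail (G n \<omega>) L) \<partial>M n) \<le> ennreal (\<delta> * \<epsilon>)"
    by (auto dest: eventually_happens)
  have "\<forall>\<^sub>F n in sequentially. \<exists>B\<in>sets (M n). measure (M n) B \<le> \<delta> \<and>
      (\<forall>\<omega>\<in>space (M n) - B. \<bar>?X n \<omega> - ?Y L n \<omega>\<bar> \<le> \<epsilon>)"
    using eventually_ge_at_top[of 1]
  proof eventually_elim
    case (elim n)
    note [measurable] = measurable_graph[OF elim]
    let ?B = "{\<omega> \<in> space (M n). \<epsilon> < degree_tail (G n \<omega>) L}"
    have "?B \<in> sets (M n)" by measurable
    moreover have "measure (M n) ?B \<le> \<delta>"
      using degree_tail_Markov[OF elim pos(1) _ tail[OF elim]] pos by simp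
    moreover have "\<bar>?X n \<omega> - ?Y L n \<omega>\<bar> \<le> \<epsilon>" if "\<omega> \<in> space (M n) - ?B" for \<omega>
    proof -
      have "\<omega> \<in> space (M n)" "degree_tail (G n \<omega>) L \<le> \<epsilon>" using that by auto
      then show ?thesis using edges_truncation[OF elim, of \<omega> L] by linarith
    qed
    ultimately show ?case by blast
  qed
  moreover have "\<forall>n\<ge>1. ?Y L n \<in> borel_measurable (M n)"
    by (intro allI impI measurable_Cmax)
  moreover have "tendsto_in_prob M (?Y L) (?c L)"
    by (rule weighted_degree_count_tendsto) simp
  moreover have "\<bar>?c L - c\<bar> \<le> \<epsilon>" using close by (simp add: dist_real_def)
  ultimately show "\<exists>Y c'. tendsto_in_prob M Y c' \<and> (\<forall>n\<ge>1. Y n \<in> borel_measurable (M n)) \<and>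
      \<bar>c' - c\<bar> \<le> \<epsilon> \<and> (\<forall>\<^sub>F n in sequentially. \<exists>B\<in>sets (M n). measure (M n) B \<le> \<delta> \<and>
        (\<forall>\<omega>\<in>space (M n) - B. \<bar>?X n \<omega> - Y n \<omega>\<bar> \<le> \<epsilon>))"
    by (intro exI[of _ "?Y L"] exI[of _ "?c L"] conjI)
qed

end

section \<open>Convergence of degree and edge counts\<close>

theorem theorem2p4:
  fixes M :: "nat \<Rightarrow> 'w measure"
    and G Cmax :: "nat \<Rightarrow> 'w \<Rightarrow> nat graph"
    and \<mu> :: "rooted_class measure"
  assumes prob_M: "\<And>n. n \<ge> 1 \<Longrightarrow> prob_space (M n)"
    and graph_G: "\<And>n. n \<ge> 1 \<Longrightarrow> is_random_graph n (M n) (G n)"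
    and meas_Cmax: "\<And>n. n \<ge> 1 \<Longrightarrow> Cmax n \<in> M n \<rightarrow>\<^sub>M count_space UNIV"
    and largest_Cmax:
      "\<And>n \<omega>. n \<ge> 1 \<Longrightarrow> \<omega> \<in> space (M n) \<Longrightarrow> is_largest_component (G n \<omega>) (Cmax n \<omega>)"
    and prob_mu: "prob_space \<mu>"
    and sets_mu: "sets \<mu> = sets local_algebra"
    and local_conv: "locally_converges_in_prob M G \<mu>"
    and almost_local:
      "(\<lambda>k. limsup (\<lambda>n. ereal (1 / real n ^ 2 *
          (\<integral>\<omega>. real (card {(x, y). x \<in> verts (G n \<omega>) \<and> y \<in> verts (G n \<omega>)
              \<and> k \<le> card (verts (component (G n \<omega>) x))
              \<and> k \<le> card (verts (component (G n \<omega>) y))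
              \<and> x \<notin> verts (component (G n \<omega>) y)}) \<partial>M n)))) \<longlonglongrightarrow> 0"
    and zeta_pos: "measure \<mu> {c. root_component_infinite c} > 0"
  shows "(\<forall>l. tendsto_in_prob M
            (\<lambda>n \<omega>. real (card {v \<in> verts (Cmax n \<omega>). degree (Cmax n \<omega>) v = l}) / real n)
            (measure \<mu> {c. root_component_infinite c \<and> root_degree c = l}))
       \<and> (uniformly_integrable {1..} (\<lambda>n. uniform_root_law (M n) (G n))
              (\<lambda>n (H, v). real (degree H v))
          \<longrightarrow> integrable \<mu> (\<lambda>c. real (root_degree c) * indicator {c. root_component_infinite c} c)
            \<and> tendsto_in_prob M
                (\<lambda>n \<omega>. real (card (edges (Cmax n \<omega>))) / real n)
                (1 / 2 * (\<integral>c. real (root_degree c)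
                            * indicator {c. root_component_infinite c} c \<partial>\<mu>)))"
proof -
  interpret largest_component M G Cmax \<mu>
    by (intro largest_component.intro random_graphs.intro largest_component_axioms.intro)
      (rule prob_M graph_G meas_Cmax largest_Cmax prob_mu sets_mu local_conv
        almost_local[folded separated_pairs_def] zeta_pos | assumption)+
  show ?thesis
  proof (intro conjI allI impI)
    fix l
    show "tendsto_in_prob M (\<lambda>n \<omega>. degree_count l n \<omega>) (degree_prob l)"
      by (rule degree_count_tendsto)
  next
    assume ui: "uniformly_integrable {1..} (\<lambda>n. uniform_root_law (M n) (G n))
      (\<lambda>n (H, v). real (degree H v))"
    then obtain c where lim: "(\<lambda>L. \<Sum>l\<le>L. real l / 2 * degree_prob l) \<longlonglongrightarrow> c"
      using degree_prob_convergent by (auto simp: convergent_def)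
    show "integrable \<mu> (\<lambda>c. real (root_degree c) * indicator {c. root_component_infinite c} c)"
      by (rule integrable_root_degree[OF lim])
    show "tendsto_in_prob M (\<lambda>n \<omega>. real (card (edges (Cmax n \<omega>))) / real n)
        (1 / 2 * (\<integral>c. real (root_degree c) * indicator {c. root_component_infinite c} c \<partial>\<mu>))"
      using edge_count_tendsto[OF ui lim] integral_root_degree[OF lim] by simp
  qed
qed

end
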